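(* Let $0<q<2$. There exist constants $C,c>0$ such that, for any integer $d\ge1$, and any $r,\sigma>0$, we have $$\sup_{\theta\in B_q(r)} \mathbf E_\theta\big(\hat N_q - \|\theta\|_2\big)^2 \le C\,\psi_{\sigma,q}^{\sqrt Q}(r,d),$$ and $$R^*_{\sqrt Q}(B_q(r)) \ge c\,\psi_{\sigma,q}^{\sqrt Q}(r,d).$$
   Context: Model: one observes $y_j=\theta_j+\sigma\xi_j$, $j=1,\dots,d$, where $\theta=(\theta_1,\dots,\theta_d)\in\mathbb R^d$ is an unknown vector of parameters, $\xi_j$ are i.i.d. standard normal random variables and $\sigma>0$ is the noise level. $\mathbf P_\theta$ is the probability measure of the vector of observations $(y_1,\dots,y_d)$ and $\mathbf E_\theta$ the corresponding expectation. $\|\theta\|_q=\big(\sum_{i=1}^d|\theta_i|^q\big)^{1/q}$ for $q>0$; $Q(\theta)=\sum_{i=1}^d\theta_i^2$, so that $\|\theta\|_2=\sqrt{Q(\theta)}$; $B_q(r)=\{\theta\in\mathbb R^d:\|\theta\|_q\le r\}$. The minimax risk is $$R^*_{\sqrt Q}(B_q(r))=\inf_{\hat T}\sup_{\theta\in B_q(r)}\mathbf E_\theta\big(\hat T-\|\theta\|_2\big)^2,$$ where $\inf_{\hat T}$ denotes the infimum over all estimators (functions of the observations). For any $r,\sigma,q>0$ and any integer $d\ge1$, the integer $m$ is defined by $$m=\max\{s\ge 1:\ \sigma^2\log(1+d/s^2)\le r^2s^{-2/q},\ s\in\mathbb N\}$$ if the set $\{s\ge 1:\ \sigma^2\log(1+d/s^2)\le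 r^2s^{-2/q},\ s\in\mathbb N\}$ is non-empty, and $m=0$ if this set is empty. The rate is $$\psi_{\sigma,q}^{\sqrt Q}(r,d)=\begin{cases}\sigma^2\sqrt d&\text{if } m>\sqrt d,\\ \sigma^2m\log(1+d/m^2)&\text{if } 1\le m\le\sqrt d,\\ r^2&\text{if } m=0.\end{cases}$$ The estimator is $\hat N_q=\sqrt{\max\{\hat Q_q,0\}}$, where $$\hat Q_q=\begin{cases}\sum_{j=1}^d y_j^2-d\sigma^2&\text{if } m>\sqrt d,\\ \sum_{j=1}^d(y_j^2-\tilde\alpha_m\sigma^2)\,\mathbf 1_{\{|y_j|>2\sigma\sqrt{2\log(1+d/m^2)}\}}&\text{if } 1\le m\le\sqrt d,\\ 0&\text{if } m=0,\end{cases}$$ with $\tilde\alpha_m=\mathbf E\big(X^2\mid X^2>8\log(1+d/m^2)\big)$, $X\sim\mathcal N(0,1)$, and $\mathbf 1_{\{\cdot\}}$ the indicator function.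
   Formalization: When the set defining m is infinite (always for 1<q<2; for q=1 if r²≥dσ²) its maximum does not exist; m is then taken as the largest element s ≤ ⌊√d⌋+1 of the set (0 if none). Reading m=∞ would make the lower bound false for 1<q<2 as r→0. *)

theory Defs
  imports "HOL-Probability.Probability" "HOL-Real_Asymp.Real_Asymp"
begin

text \<open>
  The dimension \<open>d\<close> varies under the scope of the constants, so \<open>\<real>\<^sup>d\<close> is the set of
  extensional functions on \<open>{1..d}\<close>.
\<close>

definition lq_norm :: "nat \<Rightarrow> real \<Rightarrow> (nat \<Rightarrow> real) \<Rightarrow> real" where
  "lq_norm d q \<theta> = (\<Sum>i\<in>{1..d}. \<bar>\<theta> i\<bar> powr q) powr (1 / q)"

definition lq_ball :: "nat \<Rightarrow> real \<Rightarrow> real \<Rightarrow> (nat \<Rightarrow> real) set" where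
  "lq_ball d q r = {\<theta> \<in> {1..d} \<rightarrow>\<^sub>E UNIV. lq_norm d q \<theta> \<le> r}"

definition quad :: "nat \<Rightarrow> (nat \<Rightarrow> real) \<Rightarrow> real" where
  "quad d \<theta> = (\<Sum>i\<in>{1..d}. (\<theta> i)\<^sup>2)"

abbreviation std_normal :: "real measure" where
  "std_normal \<equiv> density lborel (\<lambda>x. ennreal (std_normal_density x))"

definition obs_space :: "nat \<Rightarrow> (nat \<Rightarrow> real) measure" where
  "obs_space d = Pi\<^sub>M {1..d} (\<lambda>_. borel)"

definition obs_measure :: "nat \<Rightarrow> real \<Rightarrow> (nat \<Rightarrow> real) \<Rightarrow> (nat \<Rightarrow> real) measure" where
  "obs_measure d \<sigma> \<theta> =
     distr (Pi\<^sub>M {1..d} (\<lambda>_. std_normal)) (obs_space d) (\<lambda>\<xi>. \<lambda>j\<in>{1..d}. \<theta> j + \<sigma> * \<xi> j)"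

text \<open>Risks take values in \<open>[0, \<infinity>]\<close>: an arbitrary estimator need not have a finite second moment.\<close>

definition risk ::
  "nat \<Rightarrow> real \<Rightarrow> ((nat \<Rightarrow> real) \<Rightarrow> real) \<Rightarrow> (nat \<Rightarrow> real) \<Rightarrow> ennreal" where
  "risk d \<sigma> T \<theta> = (\<integral>\<^sup>+ y. ennreal ((T y - sqrt (quad d \<theta>))\<^sup>2) \<partial>obs_measure d \<sigma> \<theta>)"

definition max_risk ::
  "nat \<Rightarrow> real \<Rightarrow> (nat \<Rightarrow> real) set \<Rightarrow> ((nat \<Rightarrow> real) \<Rightarrow> real) \<Rightarrow> ennreal" where
  "max_risk d \<sigma> \<Theta> T = (SUP \<theta>\<in>\<Theta>. risk d \<sigma> T \<theta>)"

definition minimax_risk :: "nat \<Rightarrow> real \<Rightarrow> (nat \<Rightarrow> real) set \<Rightarrow> ennreal" where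
  "minimax_risk d \<sigma> \<Theta> = (INF T\<in>borel_measurable (obs_space d). max_risk d \<sigma> \<Theta> T)"

definition index_set :: "real \<Rightarrow> real \<Rightarrow> real \<Rightarrow> nat \<Rightarrow> nat set" where
  "index_set \<sigma> q r d =
     {s. 1 \<le> s \<and> \<sigma>\<^sup>2 * ln (1 + real d / (real s)\<^sup>2) \<le> r\<^sup>2 * real s powr (- 2 / q)}"

text \<open>
  The integer \<open>m\<close> is the maximum of \<open>index_set\<close>, and \<open>0\<close> if that set is empty.  The set can
  however be infinite, so that it has no maximum: always when \<open>q > 1\<close> (see the lemma
  below), and for \<open>q = 1\<close> when \<open>r\<^sup>2 \<ge> d \<sigma>\<^sup>2\<close>; never when \<open>q < 1\<close>.  Only the
  comparison of \<open>m\<close> with \<open>sqrt d\<close> matters once \<open>m > sqrt d\<close>, so in the infinite case the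
  search is stopped at the first integer above \<open>sqrt d\<close>.  For \<open>q = 1\<close> this gives
  \<open>m > sqrt d\<close>, as \<open>m = \<infinity>\<close> would.  For \<open>q > 1\<close> the value \<open>m = \<infinity>\<close> would be
  wrong: the rate would be \<open>\<sigma>\<^sup>2 sqrt d\<close> for every \<open>r\<close>, while the estimator \<open>0\<close>
  has maximal risk at most \<open>r\<^sup>2\<close>.
\<close>

definition m_index :: "real \<Rightarrow> real \<Rightarrow> real \<Rightarrow> nat \<Rightarrow> nat" where
  "m_index \<sigma> q r d =
     (let S = index_set \<sigma> q r d;
          S' = (if finite S then S else S \<inter> {..nat \<lfloor>sqrt (real d)\<rfloor> + 1})
      in if S' = {} then 0 else Max S')"

lemma infinite_index_set:
  assumes "1 < q" "0 < r"
  shows "infinite (index_set \<sigma> q r d)"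
proof -
  define e where "e = 2 - 2 / q"
  have "e > 0"
    using assms by (simp add: e_def field_simps)
  then have "filterlim (\<lambda>s::nat. real s powr e) at_top sequentially"
    by real_asymp
  then have "eventually (\<lambda>s. \<sigma>\<^sup>2 * real d / r\<^sup>2 \<le> real s powr e) sequentially"
    by (auto simp: filterlim_at_top)
  then have "eventually (\<lambda>s. s \<in> index_set \<sigma> q r d) sequentially"
    using eventually_ge_at_top[of "1::nat"]
  proof eventually_elim
    case (elim s)
    have s: "real s > 0"
      using elim by simp
    have "\<sigma>\<^sup>2 * ln (1 + real d / (real s)\<^sup>2) \<le> \<sigma>\<^sup>2 * (real d / (real s)\<^sup>2)"
      by (intro mult_left_mono ln_add_one_self_le_self) auto
    also have "\<dots> = (\<sigma>\<^sup>2 * real d) / (real s)\<^sup>2"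
      by simp
    also have "\<dots> \<le> (r\<^sup>2 * real s powr e) / (real s)\<^sup>2"
      using elim(1) assms by (intro divide_right_mono) (auto simp: field_simps)
    also have "\<dots> = r\<^sup>2 * (real s powr e / real s powr 2)"
      using s by (simp add: powr_numeral)
    also have "\<dots> = r\<^sup>2 * real s powr (- 2 / q)"
      by (simp add: powr_diff[symmetric] e_def del: powr_numeral)
    finally show ?case
      using elim by (simp add: index_set_def)
  qed
  then obtain N where "{N..} \<subseteq> index_set \<sigma> q r d"
    by (auto simp: eventually_sequentially)
  then show ?thesis
    using infinite_Ici finite_subset by blast
qed

definition rate :: "real \<Rightarrow> real \<Rightarrow> real \<Rightarrow> nat \<Rightarrow> real" where
  "rate \<sigma> q r d =
     (let m = m_index \<sigma> q r d in
      if real m > sqrt (real d) then \<sigma>\<^sup>2 * sqrt (real d)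
      else if 1 \<le> m then \<sigma>\<^sup>2 * real m * ln (1 + real d / (real m)\<^sup>2)
      else r\<^sup>2)"

text \<open>\<open>alpha_tilde d m\<close> is \<open>E (X\<^sup>2 | X\<^sup>2 > 8 log (1 + d / m\<^sup>2))\<close> for a standard normal \<open>X\<close>.\<close>

definition alpha_tilde :: "nat \<Rightarrow> nat \<Rightarrow> real" where
  "alpha_tilde d m =
     (let A = {x. x\<^sup>2 > 8 * ln (1 + real d / (real m)\<^sup>2)}
      in (\<integral>x. x\<^sup>2 * indicator A x \<partial>std_normal) / measure std_normal A)"

definition Q_hat :: "real \<Rightarrow> real \<Rightarrow> real \<Rightarrow> nat \<Rightarrow> (nat \<Rightarrow> real) \<Rightarrow> real" where
  "Q_hat \<sigma> q r d y =
     (let m = m_index \<sigma> q r d in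
      if real m > sqrt (real d) then (\<Sum>j\<in>{1..d}. (y j)\<^sup>2) - real d * \<sigma>\<^sup>2
      else if 1 \<le> m then
        (\<Sum>j\<in>{1..d}. ((y j)\<^sup>2 - alpha_tilde d m * \<sigma>\<^sup>2) *
           of_bool (\<bar>y j\<bar> > 2 * \<sigma> * sqrt (2 * ln (1 + real d / (real m)\<^sup>2))))
      else 0)"

definition N_hat :: "real \<Rightarrow> real \<Rightarrow> real \<Rightarrow> nat \<Rightarrow> (nat \<Rightarrow> real) \<Rightarrow> real" where
  "N_hat \<sigma> q r d y = sqrt (max (Q_hat \<sigma> q r d y) 0)"

end

theory Submission
  imports Defs
begin

text \<open>
  Everything is done at unit noise level, with \<open>t = \<theta> / \<sigma>\<close>, \<open>L = log (1 + d / m\<^sup>2)\<close> and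
  threshold \<open>\<tau> = sqrt (8 * L)\<close>.

  Upper bound. Each thresholded coordinate estimates \<open>t\<^sup>2\<close> with bias of order
  \<open>min (t\<^sup>2) L\<close> and mean squared error of order \<open>exp (- L) + L * min (t\<^sup>2) L + t\<^sup>2\<close>.
  As \<open>m + 1\<close> violates the inequality defining \<open>m\<close>, the \<open>\<ell>\<^sub>q\<close> constraint makes the sum of the
  \<open>min (t\<^sup>2) L\<close> at most a multiple of \<open>R = m * L\<close>, so by independence \<open>Q\<close> is estimated with
  mean squared error of order \<open>R\<^sup>2 + Q\<close>. For \<open>m > sqrt d\<close> the same holds with \<open>R = sqrt d\<close> and
  no threshold. The inequality
  \<open>(sqrt (max a 0) - sqrt b)\<^sup>2 \<le> 2 * (a - b)\<^sup>2 / (R + b) + R\<close> turns this into a risk of order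
  \<open>R\<close> for the norm.

  Lower bound. Test \<open>\<theta> = 0\<close> against a uniform mixture of vectors with \<open>s\<close> equal spikes, one in each
  of \<open>s\<close> disjoint blocks of \<open>d div s\<close> coordinates. Independence of the blocks makes the number of
  common spikes of two such vectors binomial, so that the \<open>\<chi>\<^sup>2\<close>-divergence is explicit and stays
  bounded as long as the squared spike height is at most \<open>\<sigma>\<^sup>2 * log (1 + d / s\<^sup>2)\<close>.
\<close>

section \<open>Gaussian expectations\<close>

lemma prob_space_std_normal: "prob_space std_normal"
  using prob_space_normal_density[of 1 0] by simp

lemma measure_std_normal_UNIV [simp]: "measure std_normal UNIV = 1"
  using prob_space.prob_space[OF prob_space_std_normal] by simp

lemma measurable_std_normal [simp]: "measurable std_normal N = measurable borel N"
  by (simp add: measurable_def)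

lemma integrable_std_normal:
  fixes f :: "real \<Rightarrow> real"
  assumes "f \<in> borel_measurable borel"
  shows "integrable std_normal f \<longleftrightarrow> integrable lborel (\<lambda>x. std_normal_density x * f x)"
  using assms by (subst integrable_real_density) auto

lemma integral_std_normal:
  fixes f :: "real \<Rightarrow> real"
  assumes "f \<in> borel_measurable borel"
  shows "integral\<^sup>L std_normal f = (\<integral>x. std_normal_density x * f x \<partial>lborel)"
  using assms by (subst integral_real_density) auto

lemma std_normal_shift:
  "distr std_normal borel (\<lambda>x. t + x) = density std_normal (\<lambda>x. ennreal (exp (t * x - t\<^sup>2 / 2)))"
proof (rule measure_eqI)
  fix A :: "real set"
  assume "A \<in> sets (distr std_normal borel (\<lambda>x. t + x))"
  then have A [measurable]: "A \<in> sets borel" by simp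
  have dens: "std_normal_density (x - t) = std_normal_density x * exp (t * x - t\<^sup>2 / 2)" for x
    by (simp add: std_normal_density_def exp_add [symmetric] power2_eq_square field_simps)
  have "emeasure (distr std_normal borel (\<lambda>x. t + x)) A =
      emeasure std_normal ((\<lambda>x. t + x) -` A)"
    by (subst emeasure_distr) auto
  also have "\<dots> = (\<integral>\<^sup>+x. ennreal (std_normal_density x) * indicator A (t + x) \<partial>lborel)"
    by (subst emeasure_density)
      (auto intro!: nn_integral_cong simp: indicator_def measurable_sets_borel[of _ borel])
  also have "\<dots> = (\<integral>\<^sup>+x. ennreal (std_normal_density (x - t)) * indicator A x \<partial>lborel)"
    by (subst nn_integral_real_affine[where c = 1 and t = t, of "\<lambda>x. _ (x - t) * indicator A x"]) auto
  also have "\<dots> = (\<integral>\<^sup>+x. ennreal (std_normal_density x) *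
      (ennreal (exp (t * x - t\<^sup>2 / 2)) * indicator A x) \<partial>lborel)"
    by (simp add: dens ennreal_mult mult.assoc)
  also have "\<dots> = emeasure (density std_normal (\<lambda>x. ennreal (exp (t * x - t\<^sup>2 / 2)))) A"
    by (subst emeasure_density) (auto simp: nn_integral_density)
  finally show "emeasure (distr std_normal borel (\<lambda>x. t + x)) A =
    emeasure (density std_normal (\<lambda>x. ennreal (exp (t * x - t\<^sup>2 / 2)))) A" .
qed simp

lemma std_normal_reflect: "distr std_normal borel uminus = std_normal"
proof (rule measure_eqI)
  fix A :: "real set"
  assume "A \<in> sets (distr std_normal borel uminus)"
  then have A [measurable]: "A \<in> sets borel" by simp
  have "emeasure (distr std_normal borel uminus) A = emeasure std_normal (uminus -` A)"
    by (subst emeasure_distr) auto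
  also have "\<dots> = (\<integral>\<^sup>+x. ennreal (std_normal_density x) * indicator A (- x) \<partial>lborel)"
    by (subst emeasure_density)
      (auto intro!: nn_integral_cong simp: indicator_def measurable_sets_borel[of _ borel])
  also have "\<dots> = (\<integral>\<^sup>+x. ennreal (std_normal_density x) * indicator A x \<partial>lborel)"
    by (subst nn_integral_real_affine[where c = "-1" and t = 0, of "\<lambda>x. _ x * indicator A x"])
      (auto simp: std_normal_density_def)
  also have "\<dots> = emeasure std_normal A"
    by (subst emeasure_density) auto
  finally show "emeasure (distr std_normal borel uminus) A = emeasure std_normal A" .
qed simp

lemma
  fixes f :: "real \<Rightarrow> real"
  assumes [measurable]: "f \<in> borel_measurable borel"
  shows integral_std_normal_shift:
      "(\<integral>x. f (t + x) \<partial>std_normal) = (\<integral>x. exp (t * x - t\<^sup>2 / 2) * f x \<partial>std_normal)"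
    and integrable_std_normal_shift:
      "integrable std_normal (\<lambda>x. f (t + x)) \<longleftrightarrow>
       integrable std_normal (\<lambda>x. exp (t * x - t\<^sup>2 / 2) * f x)"
proof -
  have "(\<integral>x. f (t + x) \<partial>std_normal) = integral\<^sup>L (distr std_normal borel (\<lambda>x. t + x)) f"
    by (subst integral_distr) auto
  also have "\<dots> = (\<integral>x. exp (t * x - t\<^sup>2 / 2) * f x \<partial>std_normal)"
    unfolding std_normal_shift by (subst integral_real_density) auto
  finally show "(\<integral>x. f (t + x) \<partial>std_normal) = (\<integral>x. exp (t * x - t\<^sup>2 / 2) * f x \<partial>std_normal)" .
  have "integrable std_normal (\<lambda>x. f (t + x)) \<longleftrightarrow> integrable (distr std_normal borel (\<lambda>x. t + x)) f"
    by (subst integrable_distr_eq) auto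
  also have "\<dots> \<longleftrightarrow> integrable std_normal (\<lambda>x. exp (t * x - t\<^sup>2 / 2) * f x)"
    unfolding std_normal_shift by (subst integrable_real_density) auto
  finally show "integrable std_normal (\<lambda>x. f (t + x)) \<longleftrightarrow>
    integrable std_normal (\<lambda>x. exp (t * x - t\<^sup>2 / 2) * f x)" .
qed

lemma integral_std_normal_odd:
  fixes f :: "real \<Rightarrow> real"
  assumes [measurable]: "f \<in> borel_measurable borel" and odd: "\<And>x. f (- x) = - f x"
  shows "(\<integral>x. f x \<partial>std_normal) = 0"
proof -
  have "(\<integral>x. f x \<partial>std_normal) = (\<integral>x. f x \<partial>distr std_normal borel uminus)"
    by (simp add: std_normal_reflect)
  also have "\<dots> = (\<integral>x. f (- x) \<partial>std_normal)"
    by (subst integral_distr) auto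
  also have "\<dots> = - (\<integral>x. f x \<partial>std_normal)"
    by (simp add: odd)
  finally show ?thesis by simp
qed

lemma integrable_std_normal_power: "integrable std_normal (\<lambda>x. x ^ k)"
  by (subst integrable_std_normal) (use integrable_std_normal_moment in auto)

lemma integral_std_normal_power2: "(\<integral>x. x\<^sup>2 \<partial>std_normal) = 1"
  by (subst integral_std_normal) (use integral_std_normal_moment_even[of 1] in auto)

lemma integral_std_normal_power4: "(\<integral>x. x ^ 4 \<partial>std_normal) = 3"
  by (subst integral_std_normal)
    (use integral_std_normal_moment_even[of 2] in \<open>auto simp: fact_numeral\<close>)

lemma integrable_std_normal_power_exp: "integrable std_normal (\<lambda>x. x ^ k * exp (x\<^sup>2 / 4))"
proof -
  have "std_normal_density x * (x ^ k * exp (x\<^sup>2 / 4)) =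
      sqrt 2 * (normal_density 0 (sqrt 2) x * (x - 0) ^ k)" for x :: real
    by (simp add: normal_density_def exp_add [symmetric] real_sqrt_mult field_simps)
  then show ?thesis
    by (subst integrable_std_normal)
      (use integrable_normal_moment[of "sqrt 2" 0 k] in \<open>simp_all only: integrable_mult_right\<close>, auto)
qed

lemma
  shows integral_std_normal_mgf: "(\<integral>x. exp (t * x - t\<^sup>2 / 2) \<partial>std_normal) = 1"
    and integrable_std_normal_mgf: "integrable std_normal (\<lambda>x. exp (t * x - t\<^sup>2 / 2))"
proof -
  interpret prob_space std_normal by (rule prob_space_std_normal)
  show "(\<integral>x. exp (t * x - t\<^sup>2 / 2) \<partial>std_normal) = 1"
    using integral_std_normal_shift[of "\<lambda>_. 1" t] prob_space by simp
  show "integrable std_normal (\<lambda>x. exp (t * x - t\<^sup>2 / 2))"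
    using integrable_std_normal_shift[of "\<lambda>_. 1" t] integrable_const[of "1::real"]
    by (simp del: integrable_const)
qed

section \<open>Thresholding a single coordinate\<close>

definition exp_moment4 :: real where
  "exp_moment4 = (\<integral>x. x ^ 4 * exp (x\<^sup>2 / 4) \<partial>std_normal)"

lemma exp_moment4_nonneg: "0 \<le> exp_moment4"
  unfolding exp_moment4_def by (intro integral_nonneg_AE) auto

definition tail_moment :: "real \<Rightarrow> real" where
  "tail_moment \<tau> = (\<integral>x. x\<^sup>2 * indicator {x. \<tau> < \<bar>x\<bar>} x \<partial>std_normal) / measure std_normal {x. \<tau> < \<bar>x\<bar>}"

definition thresh :: "real \<Rightarrow> real \<Rightarrow> real" where
  "thresh \<tau> y = (y\<^sup>2 - tail_moment \<tau>) * of_bool (\<tau> < \<bar>y\<bar>)"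

lemma thresh_measurable [measurable]: "thresh \<tau> \<in> borel_measurable borel"
  unfolding thresh_def [abs_def] by measurable

lemma integrable_std_normal_tail:
  "integrable std_normal (\<lambda>x. x ^ k * indicator {x. \<tau> < \<bar>x\<bar>} x)"
  by (rule Bochner_Integration.integrable_bound[OF integrable_std_normal_power[of k]])
    (auto simp: indicator_def)

lemma tail_second_moment_le:
  assumes "0 \<le> \<tau>"
  shows "(\<integral>x. x\<^sup>2 * indicator {x. \<tau> < \<bar>x\<bar>} x \<partial>std_normal)
    \<le> (4 * \<tau>\<^sup>2 + 6) * measure std_normal {x. \<tau> < \<bar>x\<bar>}"
proof -
  interpret prob_space std_normal by (rule prob_space_std_normal)
  have m_eq: "measure std_normal {x. \<tau> < \<bar>x\<bar>} = (\<integral>x. indicator {x. \<tau> < \<bar>x\<bar>} x \<partial>std_normal)"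
    by (simp add: Bochner_Integration.integral_indicator)
  have int1: "integrable std_normal (indicator {x. \<tau> < \<bar>x\<bar>} :: real \<Rightarrow> real)"
    using integrable_std_normal_tail[of 0 \<tau>] by simp
  have scale: "(\<integral>x. x\<^sup>2 * indicator {x. 2 * \<tau> < \<bar>x\<bar>} x \<partial>std_normal)
      \<le> 6 * (\<integral>x. indicator {x. \<tau> < \<bar>x\<bar>} x \<partial>std_normal)"
  proof -
    have pt: "2 * (std_normal_density (2 * x) * ((2 * x)\<^sup>2 * indicator {x. 2 * \<tau> < \<bar>x\<bar>} (2 * x)))
        \<le> 6 * (std_normal_density x * indicator {x. \<tau> < \<bar>x\<bar>} x)" for x
    proof (cases "\<tau> < \<bar>x\<bar>")
      case True
      have d: "std_normal_density (2 * x) = std_normal_density x * exp (- (3 * x\<^sup>2 / 2))"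
        by (simp add: std_normal_density_def exp_add [symmetric] power2_eq_square field_simps)
      have "3 * x\<^sup>2 / 2 \<le> exp (3 * x\<^sup>2 / 2)"
        using exp_ge_add_one_self[of "3 * x\<^sup>2 / 2"] by linarith
      then have "exp (- (3 * x\<^sup>2 / 2)) * (3 * x\<^sup>2 / 2) \<le> 1"
        by (simp add: exp_minus field_simps)
      moreover have "exp (- (3 * x\<^sup>2 / 2)) * (3 * x\<^sup>2 / 2) = 3 / 2 * (exp (- (3 * x\<^sup>2 / 2)) * x\<^sup>2)"
        by simp
      ultimately have "8 * (exp (- (3 * x\<^sup>2 / 2)) * x\<^sup>2) \<le> 6" by linarith
      then have "std_normal_density x * (8 * (exp (- (3 * x\<^sup>2 / 2)) * x\<^sup>2)) \<le> std_normal_density x * 6"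
        by (intro mult_left_mono) auto
      then show ?thesis using True by (simp add: d abs_mult power_mult_distrib)
    qed (auto simp: abs_mult)
    have i2: "integrable lborel (\<lambda>x. std_normal_density x * (x\<^sup>2 * indicator {x. 2 * \<tau> < \<bar>x\<bar>} x))"
      using integrable_std_normal_tail[of 2 "2 * \<tau>"] by (subst (asm) integrable_std_normal) auto
    have i1: "integrable lborel (\<lambda>x. std_normal_density x * indicator {x. \<tau> < \<bar>x\<bar>} x)"
      using int1 by (subst (asm) integrable_std_normal) auto
    have "(\<integral>x. x\<^sup>2 * indicator {x. 2 * \<tau> < \<bar>x\<bar>} x \<partial>std_normal) =
        (\<integral>x. std_normal_density x * (x\<^sup>2 * indicator {x. 2 * \<tau> < \<bar>x\<bar>} x) \<partial>lborel)"
      by (subst integral_std_normal) auto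
    also have "\<dots> = (\<integral>x. 2 * (std_normal_density (2 * x) *
        ((2 * x)\<^sup>2 * indicator {x. 2 * \<tau> < \<bar>x\<bar>} (2 * x))) \<partial>lborel)"
      using lborel_integral_real_affine[of 2
        "\<lambda>x. std_normal_density x * (x\<^sup>2 * indicator {x. 2 * \<tau> < \<bar>x\<bar>} x)" 0]
      by (simp add: mult.assoc mult.left_commute)
    also have "\<dots> \<le> (\<integral>x. 6 * (std_normal_density x * indicator {x. \<tau> < \<bar>x\<bar>} x) \<partial>lborel)"
    proof (rule integral_mono[OF _ _ pt])
      show "integrable lborel (\<lambda>x. 2 * (std_normal_density (2 * x) *
          ((2 * x)\<^sup>2 * indicator {x. 2 * \<tau> < \<bar>x\<bar>} (2 * x))))"
        using lborel_integrable_real_affine[OF i2, of 2 0]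
        by (intro integrable_mult_right) (simp only: add_0 simp_thms True_implies_equals)
    qed (use i1 in simp)
    also have "\<dots> = 6 * (\<integral>x. indicator {x. \<tau> < \<bar>x\<bar>} x \<partial>std_normal)"
      by (subst integral_std_normal) auto
    finally show ?thesis .
  qed
  have "(\<integral>x. x\<^sup>2 * indicator {x. \<tau> < \<bar>x\<bar>} x \<partial>std_normal) \<le>
    (\<integral>x. 4 * \<tau>\<^sup>2 * indicator {x. \<tau> < \<bar>x\<bar>} x + x\<^sup>2 * indicator {x. 2 * \<tau> < \<bar>x\<bar>} x \<partial>std_normal)"
  proof (rule integral_mono)
    fix x :: real
    show "x\<^sup>2 * indicator {x. \<tau> < \<bar>x\<bar>} x \<le>
        4 * \<tau>\<^sup>2 * indicator {x. \<tau> < \<bar>x\<bar>} x + x\<^sup>2 * indicator {x. 2 * \<tau> < \<bar>x\<bar>} x"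
    proof (cases "\<bar>x\<bar> \<le> 2 * \<tau>")
      case True
      then have "\<bar>x\<bar>\<^sup>2 \<le> (2 * \<tau>)\<^sup>2" by (intro power_mono) auto
      then show ?thesis by (auto simp: indicator_def power_mult_distrib)
    qed (auto simp: indicator_def)
  qed (use int1 integrable_std_normal_tail[of 2] in auto)
  also have "\<dots> = 4 * \<tau>\<^sup>2 * (\<integral>x. indicator {x. \<tau> < \<bar>x\<bar>} x \<partial>std_normal) +
      (\<integral>x. x\<^sup>2 * indicator {x. 2 * \<tau> < \<bar>x\<bar>} x \<partial>std_normal)"
    using int1 integrable_std_normal_tail[of 2] by simp
  also have "\<dots> \<le> (4 * \<tau>\<^sup>2 + 6) * (\<integral>x. indicator {x. \<tau> < \<bar>x\<bar>} x \<partial>std_normal)"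
    using scale by (simp add: algebra_simps)
  finally show ?thesis by (simp only: m_eq)
qed

lemma tail_moment_nonneg: "0 \<le> tail_moment \<tau>"
  unfolding tail_moment_def by (intro divide_nonneg_nonneg integral_nonneg_AE) auto

lemma tail_moment_le:
  assumes "0 \<le> \<tau>"
  shows "tail_moment \<tau> \<le> 4 * \<tau>\<^sup>2 + 6"
proof (cases "measure std_normal {x. \<tau> < \<bar>x\<bar>} = 0")
  case False
  then have "0 < measure std_normal {x. \<tau> < \<bar>x\<bar>}"
    by (simp add: zero_less_measure_iff)
  then show ?thesis
    using tail_second_moment_le[OF assms] by (simp add: tail_moment_def divide_le_eq)
qed (simp add: tail_moment_def)

lemma integral_thresh:
  assumes "0 \<le> \<tau>"
  shows "(\<integral>x. thresh \<tau> x \<partial>std_normal) = 0"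
proof -
  interpret prob_space std_normal by (rule prob_space_std_normal)
  let ?A = "{x. \<tau> < \<bar>x\<bar>}" and ?E = "\<integral>x. x\<^sup>2 * indicator {x. \<tau> < \<bar>x\<bar>} x \<partial>std_normal"
  have "thresh \<tau> x = x\<^sup>2 * indicator ?A x - tail_moment \<tau> * indicator ?A x" for x
    by (simp add: thresh_def indicator_def)
  then have "(\<integral>x. thresh \<tau> x \<partial>std_normal) = ?E - tail_moment \<tau> * measure std_normal ?A"
    using integrable_std_normal_tail[of 2 \<tau>] integrable_std_normal_tail[of 0 \<tau>]
    by (simp add: Bochner_Integration.integral_indicator)
  also have "\<dots> = 0"
  proof (cases "measure std_normal ?A = 0")
    case True
    have "0 \<le> ?E" by (intro integral_nonneg_AE) auto
    moreover have "?E \<le> 0" using tail_second_moment_le[OF assms] True by simp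
    ultimately have "?E = 0" by (rule antisym[rotated])
    then show ?thesis by (simp add: True)
  qed (simp add: tail_moment_def)
  finally show ?thesis .
qed

lemma abs_thresh_le:
  assumes "0 \<le> \<tau>" "3 \<le> \<tau>\<^sup>2"
  shows "\<bar>thresh \<tau> x\<bar> \<le> 6 * x\<^sup>2 * of_bool (\<tau> < \<bar>x\<bar>)"
proof (cases "\<tau> < \<bar>x\<bar>")
  case True
  then have "\<tau>\<^sup>2 \<le> \<bar>x\<bar>\<^sup>2" using assms by (intro power_mono) auto
  then show ?thesis
    using True tail_moment_le[OF assms(1)] tail_moment_nonneg[of \<tau>] assms
    by (simp add: thresh_def)
qed (simp add: thresh_def)

lemma abs_exp_minus_affine_le: "\<bar>exp u - (1 + u)\<bar> \<le> u\<^sup>2 * exp \<bar>u\<bar>" for u :: real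
  using Taylor_exp_field[of u 1] by (simp add: power2_eq_square mult.commute abs_mult)

lemma abs_tilt_le:
  fixes t \<tau> x :: real
  assumes "\<bar>t\<bar> \<le> \<tau> / 8" "\<tau> < \<bar>x\<bar>"
  shows "\<bar>t * x\<bar> \<le> x\<^sup>2 / 8"
proof -
  have "\<bar>t\<bar> * \<bar>x\<bar> \<le> \<bar>x\<bar> / 8 * \<bar>x\<bar>"
    using assms by (intro mult_right_mono) auto
  then show ?thesis by (simp add: abs_mult power2_eq_square abs_mult_self_eq)
qed

context
  fixes \<tau> :: real
  assumes \<tau>: "0 \<le> \<tau>" "3 \<le> \<tau>\<^sup>2"
begin

lemma integrable_thresh_times_power: "integrable std_normal (\<lambda>x. x ^ k * thresh \<tau> x)"
proof (rule Bochner_Integration.integrable_bound)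
  show "integrable std_normal (\<lambda>x. 6 * (x ^ k * x\<^sup>2))"
    unfolding power_add [symmetric] by (intro integrable_mult_right integrable_std_normal_power)
  show "AE x in std_normal. norm (x ^ k * thresh \<tau> x) \<le> norm (6 * (x ^ k * x\<^sup>2))"
  proof (intro AE_I2)
    fix x :: real
    have "\<bar>x ^ k\<bar> * \<bar>thresh \<tau> x\<bar> \<le> \<bar>x ^ k\<bar> * (6 * x\<^sup>2)"
      using abs_thresh_le[OF \<tau>, of x] by (intro mult_left_mono) (auto simp: of_bool_def split: if_splits)
    then show "norm (x ^ k * thresh \<tau> x) \<le> norm (6 * (x ^ k * x\<^sup>2))"
      by (simp add: abs_mult mult_ac)
  qed
qed auto

lemma abs_thresh_sq_tilt_le:
  assumes "\<bar>t\<bar> \<le> \<tau> / 8"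
  shows "exp (t * x - t\<^sup>2 / 2) * (thresh \<tau> x)\<^sup>2 \<le> 36 * exp (- \<tau>\<^sup>2 / 8) * (x ^ 4 * exp (x\<^sup>2 / 4))"
proof (cases "\<tau> < \<bar>x\<bar>")
  case True
  have "\<tau>\<^sup>2 \<le> \<bar>x\<bar>\<^sup>2" using True \<tau> by (intro power_mono) auto
  then have "t * x - t\<^sup>2 / 2 \<le> - \<tau>\<^sup>2 / 8 + x\<^sup>2 / 4"
    using abs_tilt_le[OF assms True] zero_le_power2[of t] abs_ge_self[of "t * x"]
    unfolding power2_abs by linarith
  then have e: "exp (t * x - t\<^sup>2 / 2) \<le> exp (- \<tau>\<^sup>2 / 8) * exp (x\<^sup>2 / 4)"
    by (simp add: exp_add [symmetric])
  have "\<bar>thresh \<tau> x\<bar>\<^sup>2 \<le> (6 * x\<^sup>2)\<^sup>2"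
    using abs_thresh_le[OF \<tau>, of x] True by (intro power_mono) auto
  then have "(thresh \<tau> x)\<^sup>2 \<le> 36 * x ^ 4"
    by (simp add: power_mult_distrib flip: power_mult)
  from mult_mono[OF e this] show ?thesis by (simp add: mult_ac)
next
  case False
  then show ?thesis by (simp add: thresh_def)
qed

lemma
  assumes t: "\<bar>t\<bar> \<le> \<tau> / 8"
  shows integrable_thresh_sq_small: "integrable std_normal (\<lambda>x. (thresh \<tau> (t + x))\<^sup>2)"
    and integral_thresh_sq_small_le:
      "(\<integral>x. (thresh \<tau> (t + x))\<^sup>2 \<partial>std_normal) \<le> 36 * exp_moment4 * exp (- \<tau>\<^sup>2 / 8)"
proof -
  have int: "integrable std_normal (\<lambda>x. exp (t * x - t\<^sup>2 / 2) * (thresh \<tau> x)\<^sup>2)"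
  proof (rule Bochner_Integration.integrable_bound)
    show "integrable std_normal (\<lambda>x. 36 * exp (- \<tau>\<^sup>2 / 8) * (x ^ 4 * exp (x\<^sup>2 / 4)))"
      using integrable_std_normal_power_exp[of 4] by simp
    show "AE x in std_normal. norm (exp (t * x - t\<^sup>2 / 2) * (thresh \<tau> x)\<^sup>2)
        \<le> norm (36 * exp (- \<tau>\<^sup>2 / 8) * (x ^ 4 * exp (x\<^sup>2 / 4)))"
    proof (intro AE_I2)
      fix x :: real
      show "norm (exp (t * x - t\<^sup>2 / 2) * (thresh \<tau> x)\<^sup>2)
        \<le> norm (36 * exp (- \<tau>\<^sup>2 / 8) * (x ^ 4 * exp (x\<^sup>2 / 4)))"
        using abs_thresh_sq_tilt_le[OF t, of x] by (auto simp: abs_mult)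
    qed
  qed auto
  show "integrable std_normal (\<lambda>x. (thresh \<tau> (t + x))\<^sup>2)"
    using int by (subst integrable_std_normal_shift) auto
  have "(\<integral>x. (thresh \<tau> (t + x))\<^sup>2 \<partial>std_normal) =
      (\<integral>x. exp (t * x - t\<^sup>2 / 2) * (thresh \<tau> x)\<^sup>2 \<partial>std_normal)"
    by (subst integral_std_normal_shift) auto
  also have "\<dots> \<le> (\<integral>x. 36 * exp (- \<tau>\<^sup>2 / 8) * (x ^ 4 * exp (x\<^sup>2 / 4)) \<partial>std_normal)"
    using integrable_std_normal_power_exp[of 4]
    by (intro integral_mono int abs_thresh_sq_tilt_le t) auto
  also have "\<dots> = 36 * exp_moment4 * exp (- \<tau>\<^sup>2 / 8)"
    by (simp add: exp_moment4_def)
  finally show "(\<integral>x. (thresh \<tau> (t + x))\<^sup>2 \<partial>std_normal) \<le> 36 * exp_moment4 * exp (- \<tau>\<^sup>2 / 8)" .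
qed

text \<open>
  The zeroth and first order terms of the Taylor expansion of the tilting factor
  \<open>exp (t * x)\<close> drop out, since \<open>thresh \<tau>\<close> is even and has mean zero.
\<close>
lemma abs_integral_thresh_small_le:
  assumes t: "\<bar>t\<bar> \<le> \<tau> / 8"
  shows "\<bar>\<integral>x. thresh \<tau> (t + x) \<partial>std_normal\<bar> \<le> 6 * exp_moment4 * t\<^sup>2"
proof -
  let ?h = "thresh \<tau>"
  have bnd: "\<bar>(exp (t * x) - (1 + t * x)) * ?h x\<bar> \<le> 6 * t\<^sup>2 * (x ^ 4 * exp (x\<^sup>2 / 4))" for x
  proof (cases "\<tau> < \<bar>x\<bar>")
    case True
    have "\<bar>t * x\<bar> \<le> x\<^sup>2 / 4"
      using abs_tilt_le[OF t True] zero_le_power2[of x] by linarith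
    then have "(t * x)\<^sup>2 * exp \<bar>t * x\<bar> \<le> (t * x)\<^sup>2 * exp (x\<^sup>2 / 4)"
      by (intro mult_left_mono) auto
    then have 1: "\<bar>exp (t * x) - (1 + t * x)\<bar> \<le> (t * x)\<^sup>2 * exp (x\<^sup>2 / 4)"
      using abs_exp_minus_affine_le[of "t * x"] by linarith
    have 2: "\<bar>?h x\<bar> \<le> 6 * x\<^sup>2"
      using abs_thresh_le[OF \<tau>, of x] True by simp
    have "\<bar>exp (t * x) - (1 + t * x)\<bar> * \<bar>?h x\<bar> \<le> ((t * x)\<^sup>2 * exp (x\<^sup>2 / 4)) * (6 * x\<^sup>2)"
      by (rule mult_mono[OF 1 2]) auto
    also have "\<dots> = 6 * t\<^sup>2 * (x ^ 4 * exp (x\<^sup>2 / 4))"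
      by (simp add: power_mult_distrib power4_eq_xxxx power2_eq_square)
    finally show ?thesis by (simp add: abs_mult)
  qed (simp add: thresh_def)
  have int: "integrable std_normal (\<lambda>x. (exp (t * x) - (1 + t * x)) * ?h x)"
  proof (rule Bochner_Integration.integrable_bound)
    show "integrable std_normal (\<lambda>x. 6 * t\<^sup>2 * (x ^ 4 * exp (x\<^sup>2 / 4)))"
      using integrable_std_normal_power_exp[of 4] by simp
    show "AE x in std_normal. norm ((exp (t * x) - (1 + t * x)) * ?h x)
        \<le> norm (6 * t\<^sup>2 * (x ^ 4 * exp (x\<^sup>2 / 4)))"
    proof (intro AE_I2)
      fix x :: real
      show "norm ((exp (t * x) - (1 + t * x)) * ?h x) \<le> norm (6 * t\<^sup>2 * (x ^ 4 * exp (x\<^sup>2 / 4)))"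
        using bnd[of x] by (auto simp: abs_mult)
    qed
  qed auto
  have i0: "integrable std_normal ?h" and i1: "integrable std_normal (\<lambda>x. x * ?h x)"
    using integrable_thresh_times_power[of 0] integrable_thresh_times_power[of 1] by auto
  have odd: "(\<integral>x. x * ?h x \<partial>std_normal) = 0"
    by (rule integral_std_normal_odd) (auto simp: thresh_def)
  have tilt: "exp (t * x - t\<^sup>2 / 2) = exp (- t\<^sup>2 / 2) * exp (t * x)" for x
    by (simp flip: exp_add)
  have "(\<integral>x. ?h (t + x) \<partial>std_normal) = (\<integral>x. exp (t * x - t\<^sup>2 / 2) * ?h x \<partial>std_normal)"
    by (rule integral_std_normal_shift) auto
  also have "\<dots> = (\<integral>x. exp (- t\<^sup>2 / 2) * (?h x + t * (x * ?h x) +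
      (exp (t * x) - (1 + t * x)) * ?h x) \<partial>std_normal)"
    by (intro Bochner_Integration.integral_cong refl) (simp only: tilt, simp add: algebra_simps)
  also have "\<dots> = exp (- t\<^sup>2 / 2) * (\<integral>x. (exp (t * x) - (1 + t * x)) * ?h x \<partial>std_normal)"
    using Bochner_Integration.integral_add[OF Bochner_Integration.integrable_add[OF i0
        integrable_mult_right[OF i1, of t]] int]
      Bochner_Integration.integral_add[OF i0 integrable_mult_right[OF i1, of t]] odd
      integral_thresh[OF \<tau>(1)]
    by (simp only: integral_mult_right_zero mult_zero_right add_0)
  finally have "\<bar>\<integral>x. ?h (t + x) \<partial>std_normal\<bar> =
      exp (- t\<^sup>2 / 2) * \<bar>\<integral>x. (exp (t * x) - (1 + t * x)) * ?h x \<partial>std_normal\<bar>"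
    by (simp add: abs_mult)
  also have "\<dots> \<le> 1 * \<bar>\<integral>x. (exp (t * x) - (1 + t * x)) * ?h x \<partial>std_normal\<bar>"
    by (intro mult_right_mono) auto
  also have "\<dots> \<le> (\<integral>x. \<bar>(exp (t * x) - (1 + t * x)) * ?h x\<bar> \<partial>std_normal)"
    by (simp only: mult_1 integral_abs_bound)
  also have "\<dots> \<le> (\<integral>x. 6 * t\<^sup>2 * (x ^ 4 * exp (x\<^sup>2 / 4)) \<partial>std_normal)"
    using integrable_std_normal_power_exp[of 4] int by (intro integral_mono bnd) auto
  also have "\<dots> = 6 * exp_moment4 * t\<^sup>2"
    by (simp add: exp_moment4_def)
  finally show ?thesis .
qed

lemma abs_thresh_error_le: "\<bar>thresh \<tau> (t + x) - t\<^sup>2 - (2 * t * x + x\<^sup>2)\<bar> \<le> 6 * \<tau>\<^sup>2"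
proof -
  have e: "thresh \<tau> (t + x) - t\<^sup>2 - (2 * t * x + x\<^sup>2) = thresh \<tau> (t + x) - (t + x)\<^sup>2"
    by (simp add: power2_eq_square algebra_simps)
  show ?thesis
  proof (cases "\<tau> < \<bar>t + x\<bar>")
    case True
    then show ?thesis
      using \<tau> tail_moment_le[OF \<tau>(1)] tail_moment_nonneg[of \<tau>] unfolding e by (simp add: thresh_def)
  next
    case False
    then have "\<bar>t + x\<bar>\<^sup>2 \<le> \<tau>\<^sup>2" by (intro power_mono) auto
    then have "(t + x)\<^sup>2 \<le> 6 * \<tau>\<^sup>2"
      using zero_le_power2[of \<tau>] unfolding power2_abs by linarith
    then show ?thesis using False unfolding e by (simp add: thresh_def)
  qed
qed

end

lemma sum_squared_le: "(a + b)\<^sup>2 \<le> 2 * a\<^sup>2 + 2 * b\<^sup>2" for a b :: real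
proof -
  have "2 * a\<^sup>2 + 2 * b\<^sup>2 - (a + b)\<^sup>2 = (a - b)\<^sup>2"
    by (simp add: power2_eq_square algebra_simps)
  then show ?thesis using zero_le_power2[of "a - b"] by linarith
qed

definition thresh_const :: real where
  "thresh_const = 72 * exp_moment4 + 5000"

lemma thresh_const_ge: "5000 \<le> thresh_const"
  using exp_moment4_nonneg by (simp add: thresh_const_def)

context
  fixes \<tau> :: real
  assumes \<tau>: "0 \<le> \<tau>" "3 \<le> \<tau>\<^sup>2"
begin

lemma thresh_error_sq_le:
  "(thresh \<tau> (t + x) - t\<^sup>2)\<^sup>2 \<le> 16 * t\<^sup>2 * x\<^sup>2 + 4 * x ^ 4 + 72 * (\<tau>\<^sup>2)\<^sup>2"
proof -
  define w where "w = thresh \<tau> (t + x) - t\<^sup>2 - (2 * t * x + x\<^sup>2)"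
  have "\<bar>w\<bar>\<^sup>2 \<le> (6 * \<tau>\<^sup>2)\<^sup>2"
    using abs_thresh_error_le[OF \<tau>, of t x] unfolding w_def by (intro power_mono) auto
  then have w: "w\<^sup>2 \<le> 36 * (\<tau>\<^sup>2)\<^sup>2"
    by (simp add: power_mult_distrib)
  have "(thresh \<tau> (t + x) - t\<^sup>2)\<^sup>2 = ((2 * t * x + x\<^sup>2) + w)\<^sup>2"
    by (simp add: w_def)
  also have "\<dots> \<le> 2 * (2 * (2 * t * x)\<^sup>2 + 2 * (x\<^sup>2)\<^sup>2) + 2 * w\<^sup>2"
    by (rule order_trans[OF sum_squared_le])
      (intro add_mono mult_left_mono sum_squared_le order_refl, auto)
  also have "\<dots> \<le> 16 * t\<^sup>2 * x\<^sup>2 + 4 * x ^ 4 + 72 * (\<tau>\<^sup>2)\<^sup>2"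
    using w by (simp add: power_mult_distrib power4_eq_xxxx power2_eq_square)
  finally show ?thesis .
qed

lemma integrable_thresh_error_sq: "integrable std_normal (\<lambda>x. (thresh \<tau> (t + x) - t\<^sup>2)\<^sup>2)"
proof (rule Bochner_Integration.integrable_bound)
  interpret prob_space std_normal by (rule prob_space_std_normal)
  show "integrable std_normal (\<lambda>x. 16 * t\<^sup>2 * x\<^sup>2 + 4 * x ^ 4 + 72 * (\<tau>\<^sup>2)\<^sup>2)"
    using integrable_std_normal_power[of 2] integrable_std_normal_power[of 4] by simp
  show "AE x in std_normal. norm ((thresh \<tau> (t + x) - t\<^sup>2)\<^sup>2)
      \<le> norm (16 * t\<^sup>2 * x\<^sup>2 + 4 * x ^ 4 + 72 * (\<tau>\<^sup>2)\<^sup>2)"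
  proof (intro AE_I2)
    fix x :: real
    have "norm ((thresh \<tau> (t + x) - t\<^sup>2)\<^sup>2) \<le> 16 * t\<^sup>2 * x\<^sup>2 + 4 * x ^ 4 + 72 * (\<tau>\<^sup>2)\<^sup>2"
      using thresh_error_sq_le[of t x] by (simp only: real_norm_def abs_of_nonneg zero_le_power2)
    also have "\<dots> \<le> norm (16 * t\<^sup>2 * x\<^sup>2 + 4 * x ^ 4 + 72 * (\<tau>\<^sup>2)\<^sup>2)"
      by (simp only: real_norm_def abs_ge_self)
    finally show "norm ((thresh \<tau> (t + x) - t\<^sup>2)\<^sup>2) \<le> norm (16 * t\<^sup>2 * x\<^sup>2 + 4 * x ^ 4 + 72 * (\<tau>\<^sup>2)\<^sup>2)" .
  qed
qed simp

lemma integrable_thresh_error: "integrable std_normal (\<lambda>x. thresh \<tau> (t + x) - t\<^sup>2)"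
proof -
  interpret prob_space std_normal by (rule prob_space_std_normal)
  show ?thesis
    by (rule square_integrable_imp_integrable[OF _ integrable_thresh_error_sq]) simp
qed

lemma abs_thresh_bias_le:
  "\<bar>\<integral>x. thresh \<tau> (t + x) - t\<^sup>2 \<partial>std_normal\<bar> \<le> thresh_const * min (t\<^sup>2) (\<tau>\<^sup>2 / 64)"
proof -
  interpret prob_space std_normal by (rule prob_space_std_normal)
  show ?thesis
  proof (cases "\<bar>t\<bar> \<le> \<tau> / 8")
    case True
    then have "\<bar>t\<bar>\<^sup>2 \<le> (\<tau> / 8)\<^sup>2" by (intro power_mono) auto
    then have m: "min (t\<^sup>2) (\<tau>\<^sup>2 / 64) = t\<^sup>2" by (simp add: power_divide)
    have "integrable std_normal (\<lambda>x. thresh \<tau> (t + x))"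
      using Bochner_Integration.integrable_add[OF integrable_thresh_error[of t] integrable_const[of "t\<^sup>2"]]
      by simp
    then have "(\<integral>x. thresh \<tau> (t + x) - t\<^sup>2 \<partial>std_normal) = (\<integral>x. thresh \<tau> (t + x) \<partial>std_normal) - t\<^sup>2"
      by simp
    moreover have "\<bar>e - t\<^sup>2\<bar> \<le> (6 * exp_moment4 + 1) * t\<^sup>2" if "\<bar>e\<bar> \<le> 6 * exp_moment4 * t\<^sup>2" for e
      using abs_triangle_ineq4[of e "t\<^sup>2"] that by (simp add: algebra_simps)
    ultimately have "\<bar>\<integral>x. thresh \<tau> (t + x) - t\<^sup>2 \<partial>std_normal\<bar> \<le> (6 * exp_moment4 + 1) * t\<^sup>2"
      using abs_integral_thresh_small_le[OF \<tau> True] by (simp only:)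
    also have "\<dots> \<le> thresh_const * t\<^sup>2"
      using exp_moment4_nonneg by (intro mult_right_mono) (auto simp: thresh_const_def)
    finally show ?thesis by (simp only: m)
  next
    case False
    then have "(\<tau> / 8)\<^sup>2 \<le> \<bar>t\<bar>\<^sup>2" using \<tau> by (intro power_mono) auto
    then have m: "min (t\<^sup>2) (\<tau>\<^sup>2 / 64) = \<tau>\<^sup>2 / 64" by (simp add: power_divide)
    let ?w = "\<lambda>x. thresh \<tau> (t + x) - t\<^sup>2 - (2 * t * x + x\<^sup>2)"
    have i: "integrable std_normal (\<lambda>x. 2 * t * x + x\<^sup>2)"
      using integrable_std_normal_power[of 1] integrable_std_normal_power[of 2] by simp
    have iw: "integrable std_normal ?w"
      using integrable_thresh_error[of t] i by (rule Bochner_Integration.integrable_diff)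
    have "(\<integral>x. thresh \<tau> (t + x) - t\<^sup>2 \<partial>std_normal) = (\<integral>x. ?w x + (2 * t * x + x\<^sup>2) \<partial>std_normal)"
      by (intro Bochner_Integration.integral_cong refl) (rule diff_add_cancel [symmetric])
    also have "\<dots> = (\<integral>x. ?w x \<partial>std_normal) + (\<integral>x. 2 * t * x + x\<^sup>2 \<partial>std_normal)"
      using iw i by (rule Bochner_Integration.integral_add)
    also have "(\<integral>x. 2 * t * x + x\<^sup>2 \<partial>std_normal) = 1"
    proof -
      have "integrable std_normal (\<lambda>x. x)"
        using integrable_std_normal_power[of 1] by simp
      moreover have "(\<integral>x. x \<partial>std_normal) = 0"
        by (rule integral_std_normal_odd) auto
      ultimately show ?thesis
        using integrable_std_normal_power[of 2] by (simp add: integral_std_normal_power2)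
    qed
    finally have "(\<integral>x. thresh \<tau> (t + x) - t\<^sup>2 \<partial>std_normal) = (\<integral>x. ?w x \<partial>std_normal) + 1" .
    moreover have "\<bar>\<integral>x. ?w x \<partial>std_normal\<bar> \<le> 6 * \<tau>\<^sup>2"
    proof -
      have "\<bar>\<integral>x. ?w x \<partial>std_normal\<bar> \<le> (\<integral>x. \<bar>?w x\<bar> \<partial>std_normal)"
        by (rule integral_abs_bound)
      also have "\<dots> \<le> (\<integral>x. 6 * \<tau>\<^sup>2 \<partial>std_normal)"
        by (rule integral_mono[OF integrable_abs[OF iw] integrable_const abs_thresh_error_le[OF \<tau>]])
      also have "\<dots> = 6 * \<tau>\<^sup>2" by simp
      finally show ?thesis .
    qed
    moreover have "\<bar>e + 1\<bar> \<le> 5000 * (\<tau>\<^sup>2 / 64)" if "\<bar>e\<bar> \<le> 6 * \<tau>\<^sup>2" for e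
      using \<tau>(2) that by linarith
    ultimately have "\<bar>\<integral>x. thresh \<tau> (t + x) - t\<^sup>2 \<partial>std_normal\<bar> \<le> 5000 * (\<tau>\<^sup>2 / 64)"
      by (simp only:)
    also have "\<dots> \<le> thresh_const * (\<tau>\<^sup>2 / 64)"
      using thresh_const_ge by (intro mult_right_mono) auto
    finally show ?thesis by (simp only: m)
  qed
qed

lemma thresh_mse_le:
  "(\<integral>x. (thresh \<tau> (t + x) - t\<^sup>2)\<^sup>2 \<partial>std_normal)
    \<le> thresh_const * (exp (- \<tau>\<^sup>2 / 8) + \<tau>\<^sup>2 * min (t\<^sup>2) (\<tau>\<^sup>2 / 64) + t\<^sup>2)"
proof -
  interpret prob_space std_normal by (rule prob_space_std_normal)
  show ?thesis
  proof (cases "\<bar>t\<bar> \<le> \<tau> / 8")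
    case True
    then have "\<bar>t\<bar>\<^sup>2 \<le> (\<tau> / 8)\<^sup>2" by (intro power_mono) auto
    then have t: "t\<^sup>2 \<le> \<tau>\<^sup>2 / 64" and m: "min (t\<^sup>2) (\<tau>\<^sup>2 / 64) = t\<^sup>2"
      by (simp_all add: power_divide)
    note i = integrable_thresh_sq_small[OF \<tau> True]
    have "(\<integral>x. (thresh \<tau> (t + x) - t\<^sup>2)\<^sup>2 \<partial>std_normal) \<le>
        (\<integral>x. 2 * (thresh \<tau> (t + x))\<^sup>2 + 2 * (t\<^sup>2)\<^sup>2 \<partial>std_normal)"
    proof (rule integral_mono)
      show "(thresh \<tau> (t + x) - t\<^sup>2)\<^sup>2 \<le> 2 * (thresh \<tau> (t + x))\<^sup>2 + 2 * (t\<^sup>2)\<^sup>2" for x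
        using sum_squared_le[of "thresh \<tau> (t + x)" "- t\<^sup>2"] by simp
    qed (use i integrable_thresh_error_sq[of t] in auto)
    also have "\<dots> = 2 * (\<integral>x. (thresh \<tau> (t + x))\<^sup>2 \<partial>std_normal) + 2 * (t\<^sup>2)\<^sup>2"
      using i by (simp add: prob_space)
    also have "\<dots> \<le> 72 * exp_moment4 * exp (- \<tau>\<^sup>2 / 8) + 2 * (\<tau>\<^sup>2 * t\<^sup>2)"
    proof -
      have "(t\<^sup>2)\<^sup>2 = t\<^sup>2 * t\<^sup>2" by (simp add: power2_eq_square)
      also have "\<dots> \<le> \<tau>\<^sup>2 * t\<^sup>2"
        using t zero_le_power2[of \<tau>] by (intro mult_right_mono zero_le_power2) linarith
      finally show ?thesis
        using integral_thresh_sq_small_le[OF \<tau> True] by simp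
    qed
    also have "\<dots> \<le> thresh_const * exp (- \<tau>\<^sup>2 / 8) + thresh_const * (\<tau>\<^sup>2 * t\<^sup>2)"
      using exp_moment4_nonneg by (intro add_mono mult_right_mono) (auto simp: thresh_const_def)
    also have "\<dots> \<le> thresh_const * (exp (- \<tau>\<^sup>2 / 8) + \<tau>\<^sup>2 * t\<^sup>2 + t\<^sup>2)"
      using thresh_const_ge by (simp add: algebra_simps)
    finally show ?thesis by (simp only: m)
  next
    case False
    then have "(\<tau> / 8)\<^sup>2 \<le> \<bar>t\<bar>\<^sup>2" using \<tau> by (intro power_mono) auto
    then have m: "min (t\<^sup>2) (\<tau>\<^sup>2 / 64) = \<tau>\<^sup>2 / 64" by (simp add: power_divide)
    have "3 * 3 \<le> \<tau>\<^sup>2 * \<tau>\<^sup>2" using \<tau>(2) by (intro mult_mono) auto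
    then have "12 \<le> 2 * (\<tau>\<^sup>2)\<^sup>2" by (simp add: power2_eq_square)
    note p = integrable_std_normal_power[of 2] integrable_std_normal_power[of 4]
    have "(\<integral>x. (thresh \<tau> (t + x) - t\<^sup>2)\<^sup>2 \<partial>std_normal) \<le>
        (\<integral>x. 16 * t\<^sup>2 * x\<^sup>2 + 4 * x ^ 4 + 72 * (\<tau>\<^sup>2)\<^sup>2 \<partial>std_normal)"
      by (intro integral_mono thresh_error_sq_le integrable_thresh_error_sq) (use p in simp)
    also have "\<dots> = 16 * t\<^sup>2 + 12 + 72 * (\<tau>\<^sup>2)\<^sup>2"
      using p by (simp add: prob_space integral_std_normal_power2 integral_std_normal_power4)
    also have "\<dots> \<le> 5000 * t\<^sup>2 + 5000 * (\<tau>\<^sup>2 * (\<tau>\<^sup>2 / 64))"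
    proof -
      have "\<tau>\<^sup>2 * (\<tau>\<^sup>2 / 64) = (\<tau>\<^sup>2)\<^sup>2 / 64" by (simp add: power2_eq_square)
      then show ?thesis using \<open>12 \<le> 2 * (\<tau>\<^sup>2)\<^sup>2\<close> zero_le_power2[of t] by linarith
    qed
    also have "\<dots> \<le> thresh_const * t\<^sup>2 + thresh_const * (\<tau>\<^sup>2 * (\<tau>\<^sup>2 / 64))"
      using thresh_const_ge by (intro add_mono mult_right_mono) auto
    also have "\<dots> \<le> thresh_const * (exp (- \<tau>\<^sup>2 / 8) + \<tau>\<^sup>2 * (\<tau>\<^sup>2 / 64) + t\<^sup>2)"
      using thresh_const_ge by (simp add: algebra_simps)
    finally show ?thesis by (simp only: m)
  qed
qed

end

section \<open>From coordinates to the norm\<close>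

lemma
  fixes f :: "'i \<Rightarrow> 'a \<Rightarrow> real"
  assumes M: "\<And>i. prob_space (M i)" and I: "finite I" "J \<subseteq> I"
    and int: "\<And>i. i \<in> J \<Longrightarrow> integrable (M i) (f i)"
  shows integrable_PiM_prod_subset: "integrable (Pi\<^sub>M I M) (\<lambda>x. \<Prod>i\<in>J. f i (x i))"
    and integral_PiM_prod_subset:
      "(\<integral>x. (\<Prod>i\<in>J. f i (x i)) \<partial>Pi\<^sub>M I M) = (\<Prod>i\<in>J. integral\<^sup>L (M i) (f i))"
proof -
  interpret product_prob_space M I
    by (intro product_prob_spaceI M)
  define g where "g i = (if i \<in> J then f i else (\<lambda>_. 1))" for i
  have g: "integrable (M i) (g i)" for i
    using int by (auto simp: g_def intro: finite_measure.integrable_const prob_space.finite_measure M)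
  have "(\<Prod>i\<in>I. g i (x i)) = (\<Prod>i\<in>J. f i (x i))" for x
    using I by (intro prod.mono_neutral_cong_right) (auto simp: g_def)
  moreover have "(\<Prod>i\<in>I. integral\<^sup>L (M i) (g i)) = (\<Prod>i\<in>J. integral\<^sup>L (M i) (f i))"
    using I by (intro prod.mono_neutral_cong_right) (auto simp: g_def prob_space.prob_space M)
  ultimately show "integrable (Pi\<^sub>M I M) (\<lambda>x. \<Prod>i\<in>J. f i (x i))"
    "(\<integral>x. (\<Prod>i\<in>J. f i (x i)) \<partial>Pi\<^sub>M I M) = (\<Prod>i\<in>J. integral\<^sup>L (M i) (f i))"
    using product_integrable_prod[OF I(1) g] product_integral_prod[OF I(1) g] by simp_all
qed

lemma
  fixes f :: "'i \<Rightarrow> 'a \<Rightarrow> real"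
  assumes M: "\<And>i. prob_space (M i)" and I: "finite I"
    and meas: "\<And>i. i \<in> I \<Longrightarrow> f i \<in> borel_measurable (M i)"
    and sq: "\<And>i. i \<in> I \<Longrightarrow> integrable (M i) (\<lambda>x. (f i x)\<^sup>2)"
  shows integrable_PiM_sum_sq: "integrable (Pi\<^sub>M I M) (\<lambda>x. (\<Sum>i\<in>I. f i (x i))\<^sup>2)"
    and integral_PiM_sum_sq_le: "(\<integral>x. (\<Sum>i\<in>I. f i (x i))\<^sup>2 \<partial>Pi\<^sub>M I M) \<le>
      (\<Sum>i\<in>I. \<integral>x. (f i x)\<^sup>2 \<partial>M i) + (\<Sum>i\<in>I. \<bar>\<integral>x. f i x \<partial>M i\<bar>)\<^sup>2"
proof -
  have int: "integrable (M i) (f i)" if "i \<in> I" for i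
    using finite_measure.square_integrable_imp_integrable[OF prob_space.finite_measure[OF M] meas sq]
      that by blast
  have pair_int: "integrable (Pi\<^sub>M I M) (\<lambda>x. f i (x i) * f j (x j))"
    and pair: "(\<integral>x. f i (x i) * f j (x j) \<partial>Pi\<^sub>M I M) \<le>
      (if i = j then \<integral>x. (f i x)\<^sup>2 \<partial>M i else 0) + \<bar>\<integral>x. f i x \<partial>M i\<bar> * \<bar>\<integral>x. f j x \<partial>M j\<bar>"
    if ij: "i \<in> I" "j \<in> I" for i j
  proof -
    have "integrable (Pi\<^sub>M I M) (\<lambda>x. f i (x i) * f j (x j)) \<and>
      (\<integral>x. f i (x i) * f j (x j) \<partial>Pi\<^sub>M I M) =
      (if i = j then \<integral>x. (f i x)\<^sup>2 \<partial>M i else (\<integral>x. f i x \<partial>M i) * (\<integral>x. f j x \<partial>M j))"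
    proof (cases "i = j")
      case True
      then show ?thesis
        using integrable_PiM_prod_subset[where M = M, OF M I, where J = "{i}" and f = "\<lambda>i x. (f i x)\<^sup>2"]
          integral_PiM_prod_subset[where M = M, OF M I, where J = "{i}" and f = "\<lambda>i x. (f i x)\<^sup>2"] ij sq
        by (simp add: power2_eq_square)
    next
      case False
      then show ?thesis
        using integrable_PiM_prod_subset[where M = M, OF M I, where J = "{i, j}" and f = f]
          integral_PiM_prod_subset[where M = M, OF M I, where J = "{i, j}" and f = f] ij int
        by auto
    qed
    moreover have "u * v \<le> \<bar>u\<bar> * \<bar>v\<bar>" for u v :: real
      by (metis abs_ge_self abs_mult)
    ultimately show "integrable (Pi\<^sub>M I M) (\<lambda>x. f i (x i) * f j (x j))"
      "(\<integral>x. f i (x i) * f j (x j) \<partial>Pi\<^sub>M I M) \<le>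
      (if i = j then \<integral>x. (f i x)\<^sup>2 \<partial>M i else 0) + \<bar>\<integral>x. f i x \<partial>M i\<bar> * \<bar>\<integral>x. f j x \<partial>M j\<bar>"
      by auto
  qed
  have eq: "(\<Sum>i\<in>I. f i (x i))\<^sup>2 = (\<Sum>i\<in>I. \<Sum>j\<in>I. f i (x i) * f j (x j))" for x
    by (simp add: power2_eq_square sum_product)
  show "integrable (Pi\<^sub>M I M) (\<lambda>x. (\<Sum>i\<in>I. f i (x i))\<^sup>2)"
    unfolding eq by (intro Bochner_Integration.integrable_sum pair_int)
  have "(\<integral>x. (\<Sum>i\<in>I. f i (x i))\<^sup>2 \<partial>Pi\<^sub>M I M) =
      (\<Sum>i\<in>I. \<Sum>j\<in>I. \<integral>x. f i (x i) * f j (x j) \<partial>Pi\<^sub>M I M)"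
    unfolding eq by (simp add: pair_int)
  also have "\<dots> \<le> (\<Sum>i\<in>I. \<Sum>j\<in>I. (if i = j then \<integral>x. (f i x)\<^sup>2 \<partial>M i else 0) +
      \<bar>\<integral>x. f i x \<partial>M i\<bar> * \<bar>\<integral>x. f j x \<partial>M j\<bar>)"
    by (intro sum_mono pair)
  also have "\<dots> = (\<Sum>i\<in>I. \<integral>x. (f i x)\<^sup>2 \<partial>M i) + (\<Sum>i\<in>I. \<bar>\<integral>x. f i x \<partial>M i\<bar>)\<^sup>2"
    using I by (simp add: sum.distrib power2_eq_square sum_product)
  finally show "(\<integral>x. (\<Sum>i\<in>I. f i (x i))\<^sup>2 \<partial>Pi\<^sub>M I M) \<le>
      (\<Sum>i\<in>I. \<integral>x. (f i x)\<^sup>2 \<partial>M i) + (\<Sum>i\<in>I. \<bar>\<integral>x. f i x \<partial>M i\<bar>)\<^sup>2" .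
qed

lemma sqrt_max_diff_sq_le:
  fixes a b R :: real
  assumes "0 \<le> b" "0 < R"
  shows "(sqrt (max a 0) - sqrt b)\<^sup>2 \<le> 2 * (a - b)\<^sup>2 / (R + b) + R"
proof -
  define u v where "u = sqrt (max a 0)" and "v = sqrt b"
  have u: "0 \<le> u" "u\<^sup>2 = max a 0" and v: "0 \<le> v" "v\<^sup>2 = b"
    using assms by (auto simp: u_def v_def)
  have ab: "(u\<^sup>2 - v\<^sup>2)\<^sup>2 \<le> (a - b)\<^sup>2"
    using assms unfolding u(2) v(2) abs_le_square_iff [symmetric] by auto
  have fact: "(u\<^sup>2 - v\<^sup>2)\<^sup>2 = (u - v)\<^sup>2 * (u + v)\<^sup>2"
    by (simp add: power2_eq_square algebra_simps)
  show ?thesis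
  proof (cases "b \<le> R")
    case True
    have "(u - v)\<^sup>2 * (u - v)\<^sup>2 \<le> (u - v)\<^sup>2 * (u + v)\<^sup>2"
      using u(1) v(1) by (intro mult_left_mono) (auto simp flip: abs_le_square_iff)
    then have *: "((u - v)\<^sup>2)\<^sup>2 \<le> (a - b)\<^sup>2"
      using ab fact by (simp add: power2_eq_square)
    have "p \<le> p\<^sup>2 / R + R" if "0 \<le> p" for p
    proof (cases "p \<le> R")
      case False
      then have "p * R \<le> p * p" using that by (intro mult_left_mono) auto
      then have "p \<le> p\<^sup>2 / R" using assms by (simp add: field_simps power2_eq_square)
      then show ?thesis using assms by simp
    qed (use assms in \<open>auto intro: add_increasing\<close>)
    from this[of "(u - v)\<^sup>2"] have "(u - v)\<^sup>2 \<le> ((u - v)\<^sup>2)\<^sup>2 / R + R" by simp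
    also have "\<dots> \<le> (a - b)\<^sup>2 / R + R"
      using * assms by (intro add_mono divide_right_mono) auto
    also have "(a - b)\<^sup>2 / R \<le> 2 * (a - b)\<^sup>2 / (R + b)"
    proof -
      have "(a - b)\<^sup>2 * (R + b) \<le> (a - b)\<^sup>2 * (2 * R)" using True by (intro mult_left_mono) auto
      then show ?thesis using assms by (simp add: field_simps)
    qed
    finally show ?thesis by (simp add: u_def v_def)
  next
    case False
    have "(u - v)\<^sup>2 * b \<le> (u - v)\<^sup>2 * (u + v)\<^sup>2"
      unfolding v(2) [symmetric] using u(1) v(1) by (intro mult_left_mono power_mono) auto
    then have "(u - v)\<^sup>2 * b \<le> (a - b)\<^sup>2" using ab fact by simp
    moreover have "(u - v)\<^sup>2 * (R + b) \<le> (u - v)\<^sup>2 * (2 * b)"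
      using False by (intro mult_left_mono) auto
    ultimately have "(u - v)\<^sup>2 * (R + b) \<le> 2 * (a - b)\<^sup>2" by simp
    then have "(u - v)\<^sup>2 \<le> 2 * (a - b)\<^sup>2 / (R + b)"
      using assms by (simp add: field_simps)
    then show ?thesis using assms by (simp add: u_def v_def)
  qed
qed

lemma sqrt_estimator_mse_le:
  fixes S :: "'a \<Rightarrow> real"
  assumes "prob_space M" and [measurable]: "S \<in> borel_measurable M"
    and int: "integrable M (\<lambda>x. (S x - b)\<^sup>2)"
    and mse: "(\<integral>x. (S x - b)\<^sup>2 \<partial>M) \<le> K * (R\<^sup>2 + b)"
    and "0 \<le> b" "1 / 2 \<le> R" "0 \<le> K"
  shows "(\<integral>\<^sup>+x. ennreal ((sqrt (max (S x) 0) - sqrt b)\<^sup>2) \<partial>M) \<le> ennreal ((4 * K + 1) * R)"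
proof -
  interpret prob_space M by fact
  have "(\<integral>\<^sup>+x. ennreal ((sqrt (max (S x) 0) - sqrt b)\<^sup>2) \<partial>M) \<le>
      (\<integral>\<^sup>+x. ennreal (2 / (R + b) * (S x - b)\<^sup>2 + R) \<partial>M)"
    using assms by (intro nn_integral_mono ennreal_leI order_trans[OF sqrt_max_diff_sq_le]) auto
  also have "\<dots> = ennreal (\<integral>x. 2 / (R + b) * (S x - b)\<^sup>2 + R \<partial>M)"
    using assms int by (intro nn_integral_eq_integral AE_I2) auto
  also have "(\<integral>x. 2 / (R + b) * (S x - b)\<^sup>2 + R \<partial>M) = 2 / (R + b) * (\<integral>x. (S x - b)\<^sup>2 \<partial>M) + R"
    using int by (simp add: prob_space)
  also have "\<dots> \<le> 2 / (R + b) * (K * (R\<^sup>2 + b)) + R"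
    using assms by (intro add_mono mult_left_mono) auto
  also have "\<dots> \<le> (4 * K + 1) * R"
  proof -
    have "b * 1 \<le> b * (2 * R)" using assms by (intro mult_left_mono) auto
    moreover have "2 * R * (R + b) = 2 * R\<^sup>2 + b * (2 * R)"
      by (simp add: power2_eq_square algebra_simps)
    ultimately have "R\<^sup>2 + b \<le> 2 * R * (R + b)" using zero_le_power2[of R] by linarith
    then have "2 * (K * (R\<^sup>2 + b)) \<le> 2 * (K * (2 * R * (R + b)))"
      using assms by (intro mult_left_mono) auto
    then have "2 / (R + b) * (K * (R\<^sup>2 + b)) \<le> 4 * K * R"
      using assms by (simp add: field_simps)
    then show ?thesis by (simp add: algebra_simps)
  qed
  finally show ?thesis by (simp add: ennreal_leI)
qed

lemma PiM_std_normal_component [measurable (raw)]: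
  assumes "j \<in> I" "h \<in> borel_measurable borel"
  shows "(\<lambda>x. h (x j)) \<in> borel_measurable (Pi\<^sub>M I (\<lambda>_. std_normal))"
proof -
  have "h \<in> borel_measurable std_normal"
    using assms(2) by simp
  from measurable_compose[OF measurable_component_singleton[OF assms(1)] this] show ?thesis .
qed

lemma nn_integral_obs_measure:
  assumes [measurable]: "f \<in> borel_measurable (obs_space d)"
  shows "(\<integral>\<^sup>+y. f y \<partial>obs_measure d \<sigma> \<theta>) =
    (\<integral>\<^sup>+x. f (\<lambda>j\<in>{1..d}. \<theta> j + \<sigma> * x j) \<partial>Pi\<^sub>M {1..d} (\<lambda>_. std_normal))"
proof -
  have [measurable]: "(\<lambda>x. \<lambda>j\<in>{1..d}. \<theta> j + \<sigma> * x j) \<in>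
      measurable (Pi\<^sub>M {1..d} (\<lambda>_. std_normal)) (obs_space d)"
    unfolding obs_space_def
    by (intro measurable_restrict PiM_std_normal_component[of _ _ "\<lambda>x. \<theta> j + \<sigma> * x" for j]) auto
  show ?thesis
    unfolding obs_measure_def by (rule nn_integral_distr) measurable
qed

lemma risk_sum_estimator_le:
  fixes h :: "real \<Rightarrow> real" and \<theta> :: "nat \<Rightarrow> real" and \<sigma> :: real
  defines "t \<equiv> \<lambda>j. \<theta> j / \<sigma>"
  assumes "0 < \<sigma>" and h [measurable]: "h \<in> borel_measurable borel"
    and "1 / 2 \<le> R" "0 \<le> K"
    and T: "\<And>y. T y = sqrt (max (\<sigma>\<^sup>2 * (\<Sum>j\<in>{1..d}. h (y j / \<sigma>))) 0)"
    and sq: "\<And>j. integrable std_normal (\<lambda>x. (h (t j + x) - (t j)\<^sup>2)\<^sup>2)"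
    and mse: "(\<Sum>j\<in>{1..d}. \<integral>x. (h (t j + x) - (t j)\<^sup>2)\<^sup>2 \<partial>std_normal) +
      (\<Sum>j\<in>{1..d}. \<bar>\<integral>x. h (t j + x) - (t j)\<^sup>2 \<partial>std_normal\<bar>)\<^sup>2 \<le> K * (R\<^sup>2 + (\<Sum>j\<in>{1..d}. (t j)\<^sup>2))"
  shows "risk d \<sigma> T \<theta> \<le> ennreal ((4 * K + 1) * R * \<sigma>\<^sup>2)"
proof -
  let ?I = "{1..d}" and ?N = "Pi\<^sub>M {1..d} (\<lambda>_. std_normal)"
  define b where "b = (\<Sum>j\<in>?I. (t j)\<^sup>2)"
  define S where "S x = (\<Sum>j\<in>?I. h (t j + x j))" for x
  have N: "prob_space ?N"
    by (intro prob_space_PiM prob_space_std_normal)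
  have S [measurable]: "S \<in> borel_measurable ?N"
    unfolding S_def [abs_def]
    by (intro borel_measurable_sum PiM_std_normal_component[of _ _ "\<lambda>x. h (t j + x)" for j]) auto
  have T_meas: "T \<in> borel_measurable (obs_space d)"
    unfolding T [abs_def] obs_space_def by measurable
  have S_b: "S x - b = (\<Sum>j\<in>?I. h (t j + x j) - (t j)\<^sup>2)" for x
    by (simp add: S_def b_def sum_subtractf)
  have "(\<integral>x. (S x - b)\<^sup>2 \<partial>?N) \<le> K * (R\<^sup>2 + b)"
    unfolding S_b
    using integral_PiM_sum_sq_le[where M = "\<lambda>_. std_normal" and I = ?I
        and f = "\<lambda>j x. h (t j + x) - (t j)\<^sup>2", OF prob_space_std_normal _ _ sq] mse [folded b_def]
    by simp
  moreover have "integrable ?N (\<lambda>x. (S x - b)\<^sup>2)"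
    unfolding S_b
    by (rule integrable_PiM_sum_sq[where M = "\<lambda>_. std_normal" and I = ?I
        and f = "\<lambda>j x. h (t j + x) - (t j)\<^sup>2", OF prob_space_std_normal _ _ sq]) simp_all
  ultimately have S_le: "(\<integral>\<^sup>+x. ennreal ((sqrt (max (S x) 0) - sqrt b)\<^sup>2) \<partial>?N)
      \<le> ennreal ((4 * K + 1) * R)"
    using assms by (intro sqrt_estimator_mse_le[OF N S]) (auto simp: b_def intro: sum_nonneg)
  have quad: "sqrt (quad d \<theta>) = \<sigma> * sqrt b"
  proof -
    have "quad d \<theta> = \<sigma>\<^sup>2 * b"
      using \<open>0 < \<sigma>\<close> by (simp add: quad_def b_def t_def power_divide sum_distrib_left)
    then show ?thesis using \<open>0 < \<sigma>\<close> by (simp add: real_sqrt_mult)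
  qed
  have T_eq: "T (\<lambda>j\<in>?I. \<theta> j + \<sigma> * x j) = \<sigma> * sqrt (max (S x) 0)" for x
  proof -
    have "(\<Sum>j\<in>?I. h ((\<lambda>j\<in>?I. \<theta> j + \<sigma> * x j) j / \<sigma>)) = S x"
      using \<open>0 < \<sigma>\<close> by (auto simp: S_def t_def add_divide_distrib intro!: sum.cong)
    moreover have "max (\<sigma>\<^sup>2 * S x) 0 = \<sigma>\<^sup>2 * max (S x) 0"
      using \<open>0 < \<sigma>\<close> by (simp add: max_def zero_le_mult_iff mult_le_0_iff)
    ultimately show ?thesis
      using \<open>0 < \<sigma>\<close> by (simp only: T) (simp add: real_sqrt_mult)
  qed
  have "risk d \<sigma> T \<theta> = (\<integral>\<^sup>+x. ennreal ((T (\<lambda>j\<in>?I. \<theta> j + \<sigma> * x j) - sqrt (quad d \<theta>))\<^sup>2) \<partial>?N)"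
    unfolding risk_def using T_meas by (subst nn_integral_obs_measure) auto
  also have "\<dots> = (\<integral>\<^sup>+x. ennreal (\<sigma>\<^sup>2) * ennreal ((sqrt (max (S x) 0) - sqrt b)\<^sup>2) \<partial>?N)"
    unfolding T_eq quad
    by (simp add: ennreal_mult [symmetric] power_mult_distrib flip: right_diff_distrib)
  also have "\<dots> = ennreal (\<sigma>\<^sup>2) * (\<integral>\<^sup>+x. ennreal ((sqrt (max (S x) 0) - sqrt b)\<^sup>2) \<partial>?N)"
    by (rule nn_integral_cmult) measurable
  also have "\<dots> \<le> ennreal (\<sigma>\<^sup>2) * ennreal ((4 * K + 1) * R)"
    using S_le by (rule mult_left_mono) simp
  also have "\<dots> = ennreal ((4 * K + 1) * R * \<sigma>\<^sup>2)"
    using assms by (simp add: ennreal_mult [symmetric] mult_ac)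
  finally show ?thesis .
qed

section \<open>Upper bounds on the risk\<close>

lemma powr_neg_le_iff:
  fixes A B s e :: real
  assumes "0 < s"
  shows "A \<le> B * s powr (- e) \<longleftrightarrow> A * s powr e \<le> B"
  using assms by (simp add: powr_minus field_simps)

lemma mem_index_set:
  "s \<in> index_set \<sigma> q r d \<longleftrightarrow>
    1 \<le> s \<and> \<sigma>\<^sup>2 * ln (1 + real d / (real s)\<^sup>2) * real s powr (2 / q) \<le> r\<^sup>2"
  using powr_neg_le_iff[of "real s" "\<sigma>\<^sup>2 * ln (1 + real d / (real s)\<^sup>2)" "r\<^sup>2" "2 / q"]
  by (auto simp: index_set_def)

lemma floor_sqrt_less: "sqrt (real d) < real (nat \<lfloor>sqrt (real d)\<rfloor> + 1)"
  by (simp add: floor_le_iff) linarith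

lemma le_floor_sqrt:
  assumes "real m \<le> sqrt (real d)"
  shows "m \<le> nat \<lfloor>sqrt (real d)\<rfloor>"
  using assms by (simp add: le_nat_floor)

lemma
  fixes \<sigma> q r :: real and d :: nat
  defines "m \<equiv> m_index \<sigma> q r d" and "S \<equiv> index_set \<sigma> q r d"
  shows m_index_zero: "m = 0 \<Longrightarrow> 1 \<notin> S"
    and m_index_mem: "1 \<le> m \<Longrightarrow> m \<in> S"
    and Suc_m_index_notin: "real m \<le> sqrt (real d) \<Longrightarrow> Suc m \<notin> S"
    and m_index_infinite: "infinite S \<Longrightarrow> m \<le> nat \<lfloor>sqrt (real d)\<rfloor> + 1"
proof -
  define S' where "S' = (if finite S then S else S \<inter> {..nat \<lfloor>sqrt (real d)\<rfloor> + 1})"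
  have m: "m = (if S' = {} then 0 else Max S')"
    by (simp add: m_def m_index_def S'_def S_def Let_def)
  have fin: "finite S'" by (simp add: S'_def)
  have pos: "s \<noteq> 0" if "s \<in> S" for s using that by (auto simp: S_def index_set_def)
  have sub: "S' \<subseteq> S" by (auto simp: S'_def)
  have max_mem: "m \<in> S'" if "S' \<noteq> {}" using that fin by (simp add: m)
  show "1 \<notin> S" if "m = 0"
  proof
    assume "1 \<in> S"
    then have "1 \<in> S'" by (auto simp: S'_def)
    then show False using max_mem sub pos that by auto
  qed
  show "m \<in> S" if "1 \<le> m"
    using that max_mem sub m by (cases "S' = {}") auto
  show "Suc m \<notin> S" if "real m \<le> sqrt (real d)"
  proof
    assume "Suc m \<in> S"
    then have "Suc m \<in> S'" using le_floor_sqrt[OF that] by (auto simp: S'_def)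
    then have "Suc m \<le> Max S'" "m = Max S'" using Max_ge[OF fin] m by auto
    then show False by simp
  qed
  show "m \<le> nat \<lfloor>sqrt (real d)\<rfloor> + 1" if "infinite S"
    using that max_mem m by (cases "S' = {}") (auto simp: S'_def)
qed

lemma sum_powr_le:
  assumes "\<theta> \<in> lq_ball d q r" "0 < q" "0 < r"
  shows "(\<Sum>j\<in>{1..d}. \<bar>\<theta> j\<bar> powr q) \<le> r powr q"
proof -
  let ?s = "\<Sum>j\<in>{1..d}. \<bar>\<theta> j\<bar> powr q"
  have "?s powr (1 / q) \<le> r" using assms by (simp add: lq_ball_def lq_norm_def)
  then have "(?s powr (1 / q)) powr q \<le> r powr q"
    using assms by (intro powr_mono2) auto
  then show ?thesis
    using assms by (simp add: powr_powr sum_nonneg)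
qed

lemma quad_le:
  assumes "\<theta> \<in> lq_ball d q r" "0 < q" "q < 2" "0 < r"
  shows "quad d \<theta> \<le> r\<^sup>2"
proof -
  note s = sum_powr_le[OF assms(1,2,4)]
  have sq: "(\<theta> j)\<^sup>2 \<le> r powr (2 - q) * \<bar>\<theta> j\<bar> powr q" if "j \<in> {1..d}" for j
  proof -
    have "\<bar>\<theta> j\<bar> powr q \<le> (\<Sum>j\<in>{1..d}. \<bar>\<theta> j\<bar> powr q)"
      using that by (intro member_le_sum) auto
    also note s
    finally have "\<bar>\<theta> j\<bar> \<le> r"
      using powr_less_mono2[of q r "\<bar>\<theta> j\<bar>"] assms by (cases "\<bar>\<theta> j\<bar> \<le> r") auto
    then have "\<bar>\<theta> j\<bar> powr (2 - q) * \<bar>\<theta> j\<bar> powr q \<le> r powr (2 - q) * \<bar>\<theta> j\<bar> powr q"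
      using assms by (intro mult_right_mono powr_mono2) auto
    then show ?thesis by (simp add: powr_add [symmetric])
  qed
  have "quad d \<theta> \<le> (\<Sum>j\<in>{1..d}. r powr (2 - q) * \<bar>\<theta> j\<bar> powr q)"
    unfolding quad_def by (rule sum_mono) (rule sq)
  also have "\<dots> \<le> r powr (2 - q) * r powr q"
    using s by (simp add: sum_distrib_left [symmetric] mult_left_mono)
  also have "\<dots> = r\<^sup>2" using assms by (simp add: powr_add [symmetric])
  finally show ?thesis .
qed

lemma min_sq_le:
  fixes t B q :: real
  assumes "0 < B" "0 < q" "q < 2"
  shows "min (t\<^sup>2) B \<le> B powr (1 - q / 2) * \<bar>t\<bar> powr q"
proof (cases "t\<^sup>2 \<le> B")
  case True
  then have t: "\<bar>t\<bar> \<le> B powr (1 / 2)"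
    using assms by (simp add: powr_half_sqrt real_le_rsqrt)
  have "\<bar>t\<bar> powr (2 - q) \<le> (B powr (1 / 2)) powr (2 - q)"
    using t assms by (intro powr_mono2) auto
  also have "\<dots> = B powr (1 - q / 2)"
    by (simp add: powr_powr diff_divide_distrib)
  finally have "\<bar>t\<bar> powr (2 - q) * \<bar>t\<bar> powr q \<le> B powr (1 - q / 2) * \<bar>t\<bar> powr q"
    by (rule mult_right_mono) simp
  moreover have "\<bar>t\<bar> powr (2 - q) * \<bar>t\<bar> powr q = t\<^sup>2"
    by (simp add: powr_add [symmetric])
  ultimately show ?thesis using True by simp
next
  case False
  then have "sqrt B < sqrt (t\<^sup>2)" by (subst real_sqrt_less_iff) simp
  then have t: "B powr (1 / 2) \<le> \<bar>t\<bar>"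
    using assms by (simp add: powr_half_sqrt)
  have "B = B powr (1 - q / 2) * (B powr (1 / 2)) powr q"
    using assms by (simp add: powr_powr powr_add [symmetric])
  also have "\<dots> \<le> B powr (1 - q / 2) * \<bar>t\<bar> powr q"
    using t assms by (intro mult_left_mono powr_mono2) auto
  finally show ?thesis using False by simp
qed

lemma risk_dense_le:
  assumes "0 < \<sigma>" "1 \<le> d" "sqrt (real d) < real (m_index \<sigma> q r d)"
  shows "risk d \<sigma> (N_hat \<sigma> q r d) \<theta> \<le> ennreal (33 * (\<sigma>\<^sup>2 * sqrt (real d)))"
proof -
  interpret prob_space std_normal by (rule prob_space_std_normal)
  let ?h = "\<lambda>x :: real. x\<^sup>2 - 1"
  define t where "t j = \<theta> j / \<sigma>" for j
  note p = integrable_std_normal_power[of 2] integrable_std_normal_power[of 4]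
  have i1: "integrable std_normal (\<lambda>x. x)"
    using integrable_std_normal_power[of 1] by simp
  have e1: "(\<integral>x. x \<partial>std_normal) = 0"
    by (rule integral_std_normal_odd) auto
  have err: "?h (u + x) - u\<^sup>2 = 2 * u * x + x\<^sup>2 - 1" for u x :: real
    by (simp add: power2_eq_square algebra_simps)
  have bias: "(\<integral>x. ?h (u + x) - u\<^sup>2 \<partial>std_normal) = 0" for u
    unfolding err using i1 e1 p by (simp add: integral_std_normal_power2)
  have bnd: "(2 * u * x + x\<^sup>2 - 1)\<^sup>2 \<le> 8 * u\<^sup>2 * x\<^sup>2 + 2 * x ^ 4 - 4 * x\<^sup>2 + 2" for u x :: real
    using sum_squared_le[of "2 * u * x" "x\<^sup>2 - 1"]
    by (simp add: power2_eq_square power4_eq_xxxx algebra_simps)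
  have bnd_int: "integrable std_normal (\<lambda>x. 8 * u\<^sup>2 * x\<^sup>2 + 2 * x ^ 4 - 4 * x\<^sup>2 + 2)" for u
    using p by simp
  have sq: "integrable std_normal (\<lambda>x. (?h (u + x) - u\<^sup>2)\<^sup>2)" for u
    unfolding err
  proof (rule Bochner_Integration.integrable_bound[OF bnd_int[of u]])
    show "AE x in std_normal. norm ((2 * u * x + x\<^sup>2 - 1)\<^sup>2) \<le>
        norm (8 * u\<^sup>2 * x\<^sup>2 + 2 * x ^ 4 - 4 * x\<^sup>2 + 2)"
      unfolding real_norm_def abs_power2 by (rule AE_I2) (rule order_trans[OF bnd abs_ge_self])
  qed simp
  have mse: "(\<integral>x. (?h (u + x) - u\<^sup>2)\<^sup>2 \<partial>std_normal) \<le> 8 * u\<^sup>2 + 4" for u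
  proof -
    have "(\<integral>x. (?h (u + x) - u\<^sup>2)\<^sup>2 \<partial>std_normal) \<le>
        (\<integral>x. 8 * u\<^sup>2 * x\<^sup>2 + 2 * x ^ 4 - 4 * x\<^sup>2 + 2 \<partial>std_normal)"
      unfolding err by (rule integral_mono[OF sq[of u, unfolded err] bnd_int bnd])
    also have "\<dots> = 8 * u\<^sup>2 + 4"
      using p by (simp add: integral_std_normal_power2 integral_std_normal_power4)
    finally show ?thesis .
  qed
  have "risk d \<sigma> (N_hat \<sigma> q r d) \<theta> \<le> ennreal ((4 * 8 + 1) * sqrt (real d) * \<sigma>\<^sup>2)"
  proof (rule risk_sum_estimator_le[where h = ?h])
    show "N_hat \<sigma> q r d y = sqrt (max (\<sigma>\<^sup>2 * (\<Sum>j\<in>{1..d}. (y j / \<sigma>)\<^sup>2 - 1)) 0)" for y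
    proof -
      have "\<sigma>\<^sup>2 * (\<Sum>j\<in>{1..d}. (y j / \<sigma>)\<^sup>2 - 1) = (\<Sum>j\<in>{1..d}. (y j)\<^sup>2) - real d * \<sigma>\<^sup>2"
        using assms by (simp add: power_divide sum_subtractf sum_divide_distrib [symmetric] field_simps)
      then show ?thesis
        using assms by (simp add: N_hat_def Q_hat_def Let_def)
    qed
    have "(\<Sum>j\<in>{1..d}. \<integral>x. (?h (t j + x) - (t j)\<^sup>2)\<^sup>2 \<partial>std_normal) \<le> (\<Sum>j\<in>{1..d}. 8 * (t j)\<^sup>2 + 4)"
      by (intro sum_mono mse)
    also have "\<dots> \<le> 8 * ((sqrt (real d))\<^sup>2 + (\<Sum>j\<in>{1..d}. (t j)\<^sup>2))"
      by (simp add: sum.distrib sum_distrib_left [symmetric])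
    finally show "(\<Sum>j\<in>{1..d}. \<integral>x. (?h (\<theta> j / \<sigma> + x) - (\<theta> j / \<sigma>)\<^sup>2)\<^sup>2 \<partial>std_normal) +
        (\<Sum>j\<in>{1..d}. \<bar>\<integral>x. ?h (\<theta> j / \<sigma> + x) - (\<theta> j / \<sigma>)\<^sup>2 \<partial>std_normal\<bar>)\<^sup>2
      \<le> 8 * ((sqrt (real d))\<^sup>2 + (\<Sum>j\<in>{1..d}. (\<theta> j / \<sigma>)\<^sup>2))"
      by (simp only: bias t_def abs_zero sum.neutral_const power_zero_numeral add_0_right)
    have "1 \<le> sqrt (real d)" using assms by simp
    then show "1 / 2 \<le> sqrt (real d)" by linarith
    show "integrable std_normal (\<lambda>x. (?h (\<theta> j / \<sigma> + x) - (\<theta> j / \<sigma>)\<^sup>2)\<^sup>2)" for j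
      by (rule sq)
  qed (use assms in auto)
  then show ?thesis by (simp add: mult_ac)
qed

lemma risk_zero_le:
  assumes "m_index \<sigma> q r d = 0" "\<theta> \<in> lq_ball d q r" "0 < q" "q < 2" "0 < r" "0 < \<sigma>"
  shows "risk d \<sigma> (N_hat \<sigma> q r d) \<theta> \<le> ennreal (r\<^sup>2)"
proof -
  have N: "N_hat \<sigma> q r d y = 0" for y
    using assms(1) by (simp add: N_hat_def Q_hat_def Let_def not_less)
  have q0: "0 \<le> quad d \<theta>" by (simp add: quad_def sum_nonneg)
  have P: "prob_space (Pi\<^sub>M {1..d} (\<lambda>_. std_normal))"
    by (intro prob_space_PiM prob_space_std_normal)
  have "risk d \<sigma> (N_hat \<sigma> q r d) \<theta> =
      (\<integral>\<^sup>+x. ennreal (quad d \<theta>) \<partial>Pi\<^sub>M {1..d} (\<lambda>_. std_normal))"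
    unfolding risk_def N by (subst nn_integral_obs_measure) (auto simp: q0)
  also have "\<dots> = ennreal (quad d \<theta>)"
    using prob_space.emeasure_space_1[OF P] by simp
  also have "\<dots> \<le> ennreal (r\<^sup>2)" using quad_le[OF assms(2-5)] by (rule ennreal_leI)
  finally show ?thesis .
qed

lemma tail_moment_alpha_tilde:
  assumes "0 \<le> L" "L = ln (1 + real d / (real m)\<^sup>2)"
  shows "alpha_tilde d m = tail_moment (sqrt (8 * L))"
proof -
  have "x\<^sup>2 > 8 * L \<longleftrightarrow> sqrt (8 * L) < \<bar>x\<bar>" for x :: real
    by (metis real_sqrt_abs real_sqrt_less_iff)
  then show ?thesis
    by (simp add: alpha_tilde_def tail_moment_def Let_def flip: assms(2))
qed

lemma risk_sparse_le:
  fixes \<sigma> q r :: real and d :: nat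
  defines "m \<equiv> m_index \<sigma> q r d"
  defines "L \<equiv> ln (1 + real d / (real m)\<^sup>2)"
  assumes pos: "0 < \<sigma>" "0 < r" "0 < q" "q < 2" and m: "1 \<le> m" "real m \<le> sqrt (real d)"
    and \<theta>: "\<theta> \<in> lq_ball d q r"
  shows "risk d \<sigma> (N_hat \<sigma> q r d) \<theta> \<le>
    ennreal ((4 * (20 * thresh_const + 4 * thresh_const\<^sup>2) + 1) * (\<sigma>\<^sup>2 * real m * L))"
proof -
  define c \<tau> t R where "c = thresh_const" and "\<tau> = sqrt (8 * L)" and "t j = \<theta> j / \<sigma>" and "R = real m * L" for j
  define v where "v j = min ((t j)\<^sup>2) (\<tau>\<^sup>2 / 64)" for j
  let ?I = "{1..d}"
  have m_sq: "(real m)\<^sup>2 \<le> real d"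
    using power_mono[OF m(2), of 2] by simp
  have L: "2 / 3 \<le> L"
  proof -
    have "(2 :: real) \<le> 1 + real d / (real m)\<^sup>2" using m(1) m_sq by (simp add: field_simps)
    then have "ln 2 \<le> L" unfolding L_def by (subst ln_le_cancel_iff) auto
    then show ?thesis using ln2_ge_two_thirds by linarith
  qed
  have \<tau>_sq: "\<tau>\<^sup>2 = 8 * L" using L by (simp add: \<tau>_def)
  have \<tau>: "0 \<le> \<tau>" "3 \<le> \<tau>\<^sup>2" using L by (auto simp: \<tau>_sq) (simp add: \<tau>_def)
  have c: "5000 \<le> c" by (simp add: c_def thresh_const_ge)
  have R: "2 / 3 \<le> R"
    using mult_mono[of 1 "real m" "2 / 3" L] m(1) L by (simp add: R_def)
  have "(\<Sum>j\<in>?I. \<bar>t j\<bar> powr q) \<le> 2 * real m * L powr (q / 2)"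
  proof -
    have r_less: "\<sigma>\<^sup>2 * ln (1 + real d / (real (Suc m))\<^sup>2) * real (Suc m) powr (2 / q) > r\<^sup>2"
      using Suc_m_index_notin[of \<sigma> q r d] m(2) by (simp add: mem_index_set m_def)
    have "ln (1 + real d / (real (Suc m))\<^sup>2) \<le> L"
      unfolding L_def using m(1)
      by (subst ln_le_cancel_iff) (auto intro!: add_pos_nonneg divide_left_mono power_mono)
    moreover have "real (Suc m) powr (2 / q) \<le> (2 * real m) powr (2 / q)"
      using m(1) pos by (intro powr_mono2) auto
    ultimately have "\<sigma>\<^sup>2 * ln (1 + real d / (real (Suc m))\<^sup>2) * real (Suc m) powr (2 / q)
        \<le> \<sigma>\<^sup>2 * L * (2 * real m) powr (2 / q)"
      using L by (intro mult_mono mult_left_mono mult_nonneg_nonneg) auto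
    with r_less have "r\<^sup>2 \<le> \<sigma>\<^sup>2 * L * (2 * real m) powr (2 / q)" by simp
    then have "(r\<^sup>2) powr (q / 2) \<le> (\<sigma>\<^sup>2 * L * (2 * real m) powr (2 / q)) powr (q / 2)"
      using pos by (intro powr_mono2) auto
    also have "(r\<^sup>2) powr (q / 2) = r powr q"
      using pos powr_powr[of r 2 "q / 2"] by simp
    also have "(\<sigma>\<^sup>2 * L * (2 * real m) powr (2 / q)) powr (q / 2) = \<sigma> powr q * (2 * real m * L powr (q / 2))"
      using pos L m powr_powr[of \<sigma> 2 "q / 2"] by (simp add: powr_mult powr_powr)
    finally have rq: "r powr q \<le> \<sigma> powr q * (2 * real m * L powr (q / 2))" .
    have "\<sigma> powr q * (\<Sum>j\<in>?I. \<bar>t j\<bar> powr q) = (\<Sum>j\<in>?I. \<bar>\<theta> j\<bar> powr q)"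
      using pos by (simp add: t_def sum_distrib_left powr_mult [symmetric])
    then have "\<sigma> powr q * (\<Sum>j\<in>?I. \<bar>t j\<bar> powr q) \<le> \<sigma> powr q * (2 * real m * L powr (q / 2))"
      using sum_powr_le[OF \<theta>] pos rq by simp
    then show ?thesis using pos by simp
  qed
  then have "L powr (1 - q / 2) * (\<Sum>j\<in>?I. \<bar>t j\<bar> powr q) \<le> L powr (1 - q / 2) * (2 * real m * L powr (q / 2))"
    by (rule mult_left_mono) simp
  also have "\<dots> = 2 * real m * (L powr (1 - q / 2) * L powr (q / 2))" by simp
  also have "\<dots> = 2 * R" using L by (simp add: R_def powr_add [symmetric])
  finally have tsum: "L powr (1 - q / 2) * (\<Sum>j\<in>?I. \<bar>t j\<bar> powr q) \<le> 2 * R" .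
  have vsum: "(\<Sum>j\<in>?I. v j) \<le> 2 * R"
  proof -
    have "(\<Sum>j\<in>?I. v j) \<le> (\<Sum>j\<in>?I. L powr (1 - q / 2) * \<bar>t j\<bar> powr q)"
    proof (rule sum_mono)
      fix j
      have "v j \<le> min ((t j)\<^sup>2) L" using L by (auto simp: v_def \<tau>_sq)
      also have "\<dots> \<le> L powr (1 - q / 2) * \<bar>t j\<bar> powr q"
        using L pos by (intro min_sq_le) auto
      finally show "v j \<le> L powr (1 - q / 2) * \<bar>t j\<bar> powr q" .
    qed
    then show ?thesis using tsum by (simp add: sum_distrib_left)
  qed
  have v0: "0 \<le> v j" for j by (simp add: v_def)
  have bias: "(\<Sum>j\<in>?I. \<bar>\<integral>x. thresh \<tau> (t j + x) - (t j)\<^sup>2 \<partial>std_normal\<bar>)\<^sup>2 \<le> 4 * c\<^sup>2 * R\<^sup>2"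
  proof -
    have "(\<Sum>j\<in>?I. \<bar>\<integral>x. thresh \<tau> (t j + x) - (t j)\<^sup>2 \<partial>std_normal\<bar>) \<le> (\<Sum>j\<in>?I. c * v j)"
      unfolding c_def v_def by (intro sum_mono abs_thresh_bias_le \<tau>)
    also have "\<dots> \<le> c * (2 * R)"
      using vsum c by (simp add: sum_distrib_left [symmetric])
    finally have "(\<Sum>j\<in>?I. \<bar>\<integral>x. thresh \<tau> (t j + x) - (t j)\<^sup>2 \<partial>std_normal\<bar>)\<^sup>2 \<le> (c * (2 * R))\<^sup>2"
      by (rule power_mono) (simp add: sum_nonneg)
    also have "(c * (2 * R))\<^sup>2 = 4 * c\<^sup>2 * R\<^sup>2" by (simp add: power_mult_distrib)
    finally show ?thesis .
  qed
  have mse: "(\<Sum>j\<in>?I. \<integral>x. (thresh \<tau> (t j + x) - (t j)\<^sup>2)\<^sup>2 \<partial>std_normal)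
      \<le> c * (20 * R\<^sup>2 + (\<Sum>j\<in>?I. (t j)\<^sup>2))"
  proof -
    have "(\<Sum>j\<in>?I. \<integral>x. (thresh \<tau> (t j + x) - (t j)\<^sup>2)\<^sup>2 \<partial>std_normal) \<le>
        (\<Sum>j\<in>?I. c * (exp (- L) + 8 * L * v j + (t j)\<^sup>2))"
      by (intro sum_mono order_trans[OF thresh_mse_le[OF \<tau>]]) (simp add: c_def v_def \<tau>_sq)
    also have "\<dots> = c * (real d * exp (- L) + 8 * L * (\<Sum>j\<in>?I. v j) + (\<Sum>j\<in>?I. (t j)\<^sup>2))"
      by (simp add: sum_distrib_left [symmetric] sum.distrib)
    also have "\<dots> \<le> c * (20 * R\<^sup>2 + (\<Sum>j\<in>?I. (t j)\<^sup>2))"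
    proof -
      have "real d * exp (- L) \<le> (real m)\<^sup>2"
      proof -
        have "exp L = 1 + real d / (real m)\<^sup>2"
          unfolding L_def by (rule exp_ln) (auto intro: add_pos_nonneg)
        then have "real d \<le> (real m)\<^sup>2 * exp L" using m(1) by (simp add: field_simps)
        then show ?thesis by (simp add: exp_minus field_simps)
      qed
      also have "\<dots> \<le> 4 * R\<^sup>2"
      proof -
        have "1 * 1 \<le> (2 * L) * (2 * L)" using L by (intro mult_mono) auto
        then have "(real m)\<^sup>2 * 1 \<le> (real m)\<^sup>2 * ((2 * L) * (2 * L))" by (intro mult_left_mono) auto
        then show ?thesis by (simp add: R_def power2_eq_square mult_ac)
      qed
      finally have 1: "real d * exp (- L) \<le> 4 * R\<^sup>2" .
      have "L * (\<Sum>j\<in>?I. v j) \<le> L * (2 * R)" using vsum L by (intro mult_left_mono) auto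
      also have "\<dots> \<le> R * (2 * R)"
      proof (rule mult_right_mono)
        show "L \<le> R" using mult_right_mono[of 1 "real m" L] m(1) L by (simp add: R_def)
      qed (use R in simp)
      finally have "8 * L * (\<Sum>j\<in>?I. v j) \<le> 16 * R\<^sup>2" by (simp add: power2_eq_square)
      with 1 show ?thesis using c by (intro mult_left_mono) auto
    qed
    finally show ?thesis .
  qed
  have thr: "2 * \<sigma> * sqrt (2 * L) = \<sigma> * \<tau>"
  proof -
    have "\<tau> = sqrt (2\<^sup>2 * (2 * L))" by (simp add: \<tau>_def)
    also have "\<dots> = 2 * sqrt (2 * L)" by (subst real_sqrt_mult) simp
    finally show ?thesis by simp
  qed
  have N: "N_hat \<sigma> q r d y = sqrt (max (\<sigma>\<^sup>2 * (\<Sum>j\<in>?I. thresh \<tau> (y j / \<sigma>))) 0)" for y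
  proof -
    have "((y j)\<^sup>2 - alpha_tilde d m * \<sigma>\<^sup>2) * of_bool (\<bar>y j\<bar> > 2 * \<sigma> * sqrt (2 * L)) =
        \<sigma>\<^sup>2 * thresh \<tau> (y j / \<sigma>)" for j
    proof -
      have "\<tau> < \<bar>y j / \<sigma>\<bar> \<longleftrightarrow> 2 * \<sigma> * sqrt (2 * L) < \<bar>y j\<bar>"
        unfolding thr using pos by (simp add: field_simps)
      moreover have "alpha_tilde d m = tail_moment \<tau>"
        unfolding \<tau>_def using L by (intro tail_moment_alpha_tilde) (auto simp: L_def)
      ultimately show ?thesis
        using pos by (simp add: thresh_def power_divide field_simps)
    qed
    then have "Q_hat \<sigma> q r d y = \<sigma>\<^sup>2 * (\<Sum>j\<in>?I. thresh \<tau> (y j / \<sigma>))"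
      using m unfolding sum_distrib_left Q_hat_def Let_def m_def [symmetric] L_def [symmetric] by simp
    then show ?thesis by (simp add: N_hat_def)
  qed
  have "risk d \<sigma> (N_hat \<sigma> q r d) \<theta> \<le> ennreal ((4 * (20 * c + 4 * c\<^sup>2) + 1) * R * \<sigma>\<^sup>2)"
  proof (rule risk_sum_estimator_le[where h = "thresh \<tau>"])
    show "N_hat \<sigma> q r d y = sqrt (max (\<sigma>\<^sup>2 * (\<Sum>j\<in>?I. thresh \<tau> (y j / \<sigma>))) 0)" for y
      by (rule N)
    show "integrable std_normal (\<lambda>x. (thresh \<tau> (\<theta> j / \<sigma> + x) - (\<theta> j / \<sigma>)\<^sup>2)\<^sup>2)" for j
      by (rule integrable_thresh_error_sq[OF \<tau>])
    have T0: "0 \<le> (\<Sum>j\<in>?I. (t j)\<^sup>2)" by (simp add: sum_nonneg)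
    have "c * (20 * R\<^sup>2 + b) + 4 * c\<^sup>2 * R\<^sup>2 \<le> (20 * c + 4 * c\<^sup>2) * (R\<^sup>2 + b)" if "0 \<le> b" for b
    proof -
      have "(20 * c + 4 * c\<^sup>2) * (R\<^sup>2 + b) - (c * (20 * R\<^sup>2 + b) + 4 * c\<^sup>2 * R\<^sup>2) = (19 * c + 4 * c\<^sup>2) * b"
        by (simp add: algebra_simps)
      moreover have "0 \<le> (19 * c + 4 * c\<^sup>2) * b" using that c by simp
      ultimately show ?thesis by linarith
    qed
    from add_mono[OF mse bias] this[OF T0]
    show "(\<Sum>j\<in>?I. \<integral>x. (thresh \<tau> (\<theta> j / \<sigma> + x) - (\<theta> j / \<sigma>)\<^sup>2)\<^sup>2 \<partial>std_normal) +
        (\<Sum>j\<in>?I. \<bar>\<integral>x. thresh \<tau> (\<theta> j / \<sigma> + x) - (\<theta> j / \<sigma>)\<^sup>2 \<partial>std_normal\<bar>)\<^sup>2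
      \<le> (20 * c + 4 * c\<^sup>2) * (R\<^sup>2 + (\<Sum>j\<in>?I. (\<theta> j / \<sigma>)\<^sup>2))"
      unfolding t_def by (rule order_trans)
  qed (use pos R c in auto)
  then show ?thesis by (simp add: R_def c_def mult_ac)
qed

section \<open>Minimax lower bound\<close>

lemma ennreal_integral_le_nn_integral:
  fixes g :: "'a \<Rightarrow> real"
  assumes "integrable M g"
  shows "ennreal (\<integral>x. g x \<partial>M) \<le> (\<integral>\<^sup>+x. ennreal (g x) \<partial>M)"
proof -
  have "(\<integral>x. g x \<partial>M) \<le> (\<integral>x. max 0 (g x) \<partial>M)"
    using assms by (intro integral_mono) auto
  then have "ennreal (\<integral>x. g x \<partial>M) \<le> ennreal (\<integral>x. max 0 (g x) \<partial>M)"
    by (rule ennreal_leI)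
  also have "\<dots> = (\<integral>\<^sup>+x. ennreal (max 0 (g x)) \<partial>M)"
    using assms by (intro nn_integral_eq_integral [symmetric]) auto
  also have "\<dots> = (\<integral>\<^sup>+x. ennreal (g x) \<partial>M)"
    by (intro nn_integral_cong) (simp add: max_def ennreal_neg)
  finally show ?thesis .
qed

lemma squared_loss_ge:
  fixes T \<rho> l :: real
  assumes "0 \<le> l"
  shows "\<rho>\<^sup>2 / 2 * (l / 4 - l\<^sup>2 / 64) \<le> T\<^sup>2 + (T - \<rho>)\<^sup>2 * l"
proof -
  have sq: "\<rho>\<^sup>2 / 2 \<le> T\<^sup>2 + (T - \<rho>)\<^sup>2"
    using sum_squared_le[of T "- (T - \<rho>)"] by (simp add: power2_commute)
  have min: "l / 4 - l\<^sup>2 / 64 \<le> min 1 l"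
  proof -
    have "0 \<le> (l / 8 - 1)\<^sup>2" by simp
    then have "l / 4 - l\<^sup>2 / 64 \<le> 1" by (simp add: power2_eq_square algebra_simps)
    moreover have "l / 4 - l\<^sup>2 / 64 \<le> l" using assms zero_le_power2[of l] by linarith
    ultimately show ?thesis by simp
  qed
  have "\<rho>\<^sup>2 / 2 * (l / 4 - l\<^sup>2 / 64) \<le> \<rho>\<^sup>2 / 2 * min 1 l"
    using min by (intro mult_left_mono) auto
  also have "\<dots> \<le> (T\<^sup>2 + (T - \<rho>)\<^sup>2) * min 1 l"
    using sq assms by (intro mult_right_mono) auto
  also have "\<dots> = T\<^sup>2 * min 1 l + (T - \<rho>)\<^sup>2 * min 1 l" by (rule distrib_right)
  also have "\<dots> \<le> T\<^sup>2 * 1 + (T - \<rho>)\<^sup>2 * l" by (intro add_mono mult_left_mono) auto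
  finally show ?thesis by simp
qed

text \<open>
  Le Cam's two-point argument for the base measure against a uniform mixture: by
  \<open>squared_loss_ge\<close> it is enough to bound the second moment of the likelihood ratio, because
  \<open>min 1 l \<ge> l / 4 - l\<^sup>2 / 64\<close>.
\<close>
lemma mixture_lower_bound:
  fixes T :: "'a \<Rightarrow> real" and l :: "'p \<Rightarrow> 'a \<Rightarrow> real"
  assumes "prob_space M" and [measurable]: "T \<in> borel_measurable M"
    and P: "finite P" "P \<noteq> {}"
    and l0: "\<And>p x. 0 \<le> l p x"
    and int: "\<And>p. p \<in> P \<Longrightarrow> integrable M (l p)" "\<And>p. p \<in> P \<Longrightarrow> integral\<^sup>L M (l p) = 1"
    and int2: "\<And>p p'. p \<in> P \<Longrightarrow> p' \<in> P \<Longrightarrow> integrable M (\<lambda>x. l p x * l p' x)"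
    and chi: "(\<Sum>p\<in>P. \<Sum>p'\<in>P. \<integral>x. l p x * l p' x \<partial>M) \<le> 8 * (real (card P))\<^sup>2"
    and v0: "(\<integral>\<^sup>+x. ennreal ((T x)\<^sup>2) \<partial>M) \<le> v"
    and v1: "\<And>p. p \<in> P \<Longrightarrow> (\<integral>\<^sup>+x. ennreal ((T x - \<rho>)\<^sup>2 * l p x) \<partial>M) \<le> v"
  shows "ennreal (\<rho>\<^sup>2 / 32) \<le> v"
proof -
  interpret prob_space M by fact
  define n where "n = real (card P)"
  define L where "L x = (\<Sum>p\<in>P. l p x) / n" for x
  have n: "0 < n" using P by (simp add: n_def card_gt_0_iff)
  have [measurable]: "l p \<in> borel_measurable M" if "p \<in> P" for p
    using int(1)[OF that] by simp
  have L0: "0 \<le> L x" for x using n l0 by (simp add: L_def sum_nonneg)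
  have L_sq: "(L x)\<^sup>2 = (\<Sum>p\<in>P. \<Sum>p'\<in>P. l p x * l p' x) / n\<^sup>2" for x
    by (simp add: L_def power_divide power2_eq_square sum_product)
  have iL: "integrable M L" unfolding L_def [abs_def]
    by (intro integrable_divide Bochner_Integration.integrable_sum int)
  have EL: "(\<integral>x. L x \<partial>M) = 1"
    using n int by (simp add: L_def n_def)
  have iL2: "integrable M (\<lambda>x. (L x)\<^sup>2)" unfolding L_sq
    by (intro integrable_divide Bochner_Integration.integrable_sum int2)
  have EL2: "(\<integral>x. (L x)\<^sup>2 \<partial>M) \<le> 8"
  proof -
    have "(\<integral>x. (L x)\<^sup>2 \<partial>M) = (\<Sum>p\<in>P. \<Sum>p'\<in>P. \<integral>x. l p x * l p' x \<partial>M) / n\<^sup>2"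
      unfolding L_sq using int2 by simp
    also have "\<dots> \<le> 8" using chi n by (simp add: n_def divide_le_eq)
    finally show ?thesis .
  qed
  have "ennreal (\<rho>\<^sup>2 / 16) \<le> ennreal (\<integral>x. \<rho>\<^sup>2 / 2 * (L x / 4 - (L x)\<^sup>2 / 64) \<partial>M)"
  proof (rule ennreal_leI)
    have "\<rho>\<^sup>2 / 16 = \<rho>\<^sup>2 / 2 * (1 / 8)" by simp
    also have "\<dots> \<le> \<rho>\<^sup>2 / 2 * (1 / 4 - (\<integral>x. (L x)\<^sup>2 \<partial>M) / 64)"
      using EL2 by (intro mult_left_mono) auto
    also have "\<dots> = (\<integral>x. \<rho>\<^sup>2 / 2 * (L x / 4 - (L x)\<^sup>2 / 64) \<partial>M)"
      using iL iL2 EL by simp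
    finally show "\<rho>\<^sup>2 / 16 \<le> (\<integral>x. \<rho>\<^sup>2 / 2 * (L x / 4 - (L x)\<^sup>2 / 64) \<partial>M)" .
  qed
  also have "\<dots> \<le> (\<integral>\<^sup>+x. ennreal (\<rho>\<^sup>2 / 2 * (L x / 4 - (L x)\<^sup>2 / 64)) \<partial>M)"
    using iL iL2 by (intro ennreal_integral_le_nn_integral) auto
  also have "\<dots> \<le> (\<integral>\<^sup>+x. ennreal ((T x)\<^sup>2) + ennreal ((T x - \<rho>)\<^sup>2 * L x) \<partial>M)"
    using squared_loss_ge[OF L0] L0
    by (intro nn_integral_mono) (simp add: ennreal_plus [symmetric] ennreal_leI del: ennreal_plus)
  also have "\<dots> = (\<integral>\<^sup>+x. ennreal ((T x)\<^sup>2) \<partial>M) + (\<integral>\<^sup>+x. ennreal ((T x - \<rho>)\<^sup>2 * L x) \<partial>M)"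
    using iL by (intro nn_integral_add) auto
  also have "(\<integral>\<^sup>+x. ennreal ((T x - \<rho>)\<^sup>2 * L x) \<partial>M) =
      (\<integral>\<^sup>+x. (\<Sum>p\<in>P. ennreal (1 / n) * ennreal ((T x - \<rho>)\<^sup>2 * l p x)) \<partial>M)"
  proof (intro nn_integral_cong)
    fix x
    have "(T x - \<rho>)\<^sup>2 * L x = (\<Sum>p\<in>P. 1 / n * ((T x - \<rho>)\<^sup>2 * l p x))"
      by (simp add: L_def sum_distrib_left sum_divide_distrib)
    then have "ennreal ((T x - \<rho>)\<^sup>2 * L x) = (\<Sum>p\<in>P. ennreal (1 / n * ((T x - \<rho>)\<^sup>2 * l p x)))"
      using n l0 by (simp add: sum_ennreal del: times_divide_eq_left)
    then show "ennreal ((T x - \<rho>)\<^sup>2 * L x) = (\<Sum>p\<in>P. ennreal (1 / n) * ennreal ((T x - \<rho>)\<^sup>2 * l p x))"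
      using n l0 by (simp add: ennreal_mult del: times_divide_eq_left)
  qed
  also have "\<dots> = (\<Sum>p\<in>P. ennreal (1 / n) * (\<integral>\<^sup>+x. ennreal ((T x - \<rho>)\<^sup>2 * l p x) \<partial>M))"
    by (subst nn_integral_sum) (auto intro!: sum.cong nn_integral_cmult)
  also have "(\<integral>\<^sup>+x. ennreal ((T x)\<^sup>2) \<partial>M) +
      (\<Sum>p\<in>P. ennreal (1 / n) * (\<integral>\<^sup>+x. ennreal ((T x - \<rho>)\<^sup>2 * l p x) \<partial>M)) \<le>
      v + (\<Sum>p\<in>P. ennreal (1 / n) * v)"
    using v0 v1 by (intro add_mono sum_mono mult_left_mono) auto
  also have "(\<Sum>p\<in>P. ennreal (1 / n) * v) = (ennreal n * ennreal (1 / n)) * v"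
    by (simp add: n_def ennreal_of_nat_eq_real_of_nat mult.assoc)
  also have "\<dots> = v"
    using n by (simp add: ennreal_mult [symmetric])
  finally have "ennreal (\<rho>\<^sup>2 / 16) \<le> v + v" .
  moreover have "ennreal 2 * ennreal (\<rho>\<^sup>2 / 32) = ennreal (\<rho>\<^sup>2 / 16)"
    by (subst ennreal_mult [symmetric]) auto
  moreover have "ennreal 2 * v = v + v"
    by (simp add: mult_2)
  ultimately have "ennreal 2 * ennreal (\<rho>\<^sup>2 / 32) \<le> ennreal 2 * v" by simp
  then show ?thesis
    by (subst (asm) ennreal_mult_le_mult_iff) auto
qed

lemma PiM_std_normal_shift:
  fixes t :: "'i \<Rightarrow> real"
  assumes I: "finite I"
  defines "N \<equiv> Pi\<^sub>M I (\<lambda>_. std_normal)"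
  shows "distr N (Pi\<^sub>M I (\<lambda>_. borel)) (\<lambda>x. \<lambda>j\<in>I. t j + x j) =
    density N (\<lambda>x. ennreal (\<Prod>j\<in>I. exp (t j * x j - (t j)\<^sup>2 / 2)))"
proof -
  let ?D = "\<lambda>j. density std_normal (\<lambda>x. ennreal (exp (t j * x - (t j)\<^sup>2 / 2)))"
  have D: "prob_space (?D j)" for j
    unfolding std_normal_shift [symmetric]
    by (intro prob_space.prob_space_distr prob_space_std_normal) simp
  interpret D: product_prob_space ?D I by (intro product_prob_spaceI D)
  interpret N: product_prob_space "\<lambda>_. std_normal" I
    by (intro product_prob_spaceI prob_space_std_normal)
  have sets_N: "sets N = sets (Pi\<^sub>M I (\<lambda>_. borel :: real measure))"
    unfolding N_def by (intro sets_PiM_cong) auto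
  have space_N: "space N = I \<rightarrow>\<^sub>E UNIV" by (simp add: N_def space_PiM)
  have sets_D: "sets (Pi\<^sub>M I ?D) = sets (Pi\<^sub>M I (\<lambda>_. borel :: real measure))"
    by (intro sets_PiM_cong) auto
  have comp [measurable]: "(\<lambda>x. h (x j)) \<in> borel_measurable N"
    if "j \<in> I" "h \<in> borel_measurable borel" for h :: "real \<Rightarrow> real" and j
    unfolding N_def using that by (rule PiM_std_normal_component)
  have map_meas: "(\<lambda>x. \<lambda>j\<in>I. t j + x j) \<in> measurable N (Pi\<^sub>M I (\<lambda>_. borel))"
    by (intro measurable_restrict comp[of _ "\<lambda>x. t j + x" for j]) auto
  have "distr N (Pi\<^sub>M I (\<lambda>_. borel)) (\<lambda>x. \<lambda>j\<in>I. t j + x j) = Pi\<^sub>M I ?D"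
  proof (rule D.PiM_eqI[OF I])
    fix A assume "\<And>i. i \<in> I \<Longrightarrow> A i \<in> sets (?D i)"
    then have A: "A i \<in> sets borel" if "i \<in> I" for i using that by simp
    have A': "(\<lambda>x. t i + x) -` A i \<in> sets borel" if "i \<in> I" for i
      using measurable_sets[OF _ A[OF that], of "\<lambda>x. t i + x" borel] by simp
    have "emeasure (distr N (Pi\<^sub>M I (\<lambda>_. borel)) (\<lambda>x. \<lambda>j\<in>I. t j + x j)) (Pi\<^sub>E I A) =
        emeasure N ((\<lambda>x. \<lambda>j\<in>I. t j + x j) -` Pi\<^sub>E I A \<inter> space N)"
      using A I map_meas by (intro emeasure_distr sets_PiM_I_finite) auto
    also have "(\<lambda>x. \<lambda>j\<in>I. t j + x j) -` Pi\<^sub>E I A \<inter> space N = Pi\<^sub>E I (\<lambda>j. (\<lambda>x. t j + x) -` A j)"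
      by (auto simp: space_N PiE_iff extensional_def)
    also have "emeasure N \<dots> = (\<Prod>j\<in>I. emeasure std_normal ((\<lambda>x. t j + x) -` A j))"
      unfolding N_def using I A' by (subst N.emeasure_PiM) auto
    also have "\<dots> = (\<Prod>j\<in>I. emeasure (?D j) (A j))"
      unfolding std_normal_shift [symmetric] using A
      by (intro prod.cong refl) (simp add: emeasure_distr)
    finally show "emeasure (distr N (Pi\<^sub>M I (\<lambda>_. borel)) (\<lambda>x. \<lambda>j\<in>I. t j + x j)) (Pi\<^sub>E I A) =
        (\<Prod>j\<in>I. emeasure (?D j) (A j))" .
  qed (simp add: sets_D)
  also have "Pi\<^sub>M I ?D = density N (\<lambda>x. ennreal (\<Prod>j\<in>I. exp (t j * x j - (t j)\<^sup>2 / 2)))"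
  proof (rule D.PiM_eqI[OF I, symmetric])
    fix A assume "\<And>i. i \<in> I \<Longrightarrow> A i \<in> sets (?D i)"
    then have A [measurable]: "A i \<in> sets borel" if "i \<in> I" for i using that by simp
    have meas: "(\<lambda>x. ennreal (\<Prod>j\<in>I. exp (t j * x j - (t j)\<^sup>2 / 2))) \<in> borel_measurable N"
      by (intro measurable_compose[OF _ measurable_ennreal] borel_measurable_prod
          comp[of _ "\<lambda>x. exp (t j * x - (t j)\<^sup>2 / 2)" for j]) auto
    have "emeasure (density N (\<lambda>x. ennreal (\<Prod>j\<in>I. exp (t j * x j - (t j)\<^sup>2 / 2)))) (Pi\<^sub>E I A) =
        (\<integral>\<^sup>+x. ennreal (\<Prod>j\<in>I. exp (t j * x j - (t j)\<^sup>2 / 2)) * indicator (Pi\<^sub>E I A) x \<partial>N)"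
      using A I by (intro emeasure_density meas) (auto simp: N_def intro!: sets_PiM_I_finite)
    also have "\<dots> = (\<integral>\<^sup>+x. (\<Prod>j\<in>I. ennreal (exp (t j * x j - (t j)\<^sup>2 / 2)) * indicator (A j) (x j)) \<partial>N)"
    proof (rule nn_integral_cong)
      fix x assume "x \<in> space N"
      then have "indicator (Pi\<^sub>E I A) x = (\<Prod>j\<in>I. indicator (A j) (x j) :: ennreal)"
        using I by (auto simp: space_N PiE_iff indicator_def)
      then show "ennreal (\<Prod>j\<in>I. exp (t j * x j - (t j)\<^sup>2 / 2)) * indicator (Pi\<^sub>E I A) x =
          (\<Prod>j\<in>I. ennreal (exp (t j * x j - (t j)\<^sup>2 / 2)) * indicator (A j) (x j))"
        by (simp add: prod.distrib prod_ennreal)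
    qed
    also have "\<dots> = (\<Prod>j\<in>I. \<integral>\<^sup>+x. ennreal (exp (t j * x - (t j)\<^sup>2 / 2)) * indicator (A j) x \<partial>std_normal)"
      unfolding N_def by (rule N.product_nn_integral_prod[OF I]) simp
    also have "\<dots> = (\<Prod>j\<in>I. emeasure (?D j) (A j))"
      by (intro prod.cong refl emeasure_density [symmetric]) auto
    finally show "emeasure (density N (\<lambda>x. ennreal (\<Prod>j\<in>I. exp (t j * x j - (t j)\<^sup>2 / 2)))) (Pi\<^sub>E I A) =
        (\<Prod>j\<in>I. emeasure (?D j) (A j))" .
  qed (simp add: sets_N sets_D)
  finally show ?thesis .
qed

lemma integral_std_normal_mgf_product:
  shows "(\<integral>x. exp (u * x - u\<^sup>2 / 2) * exp (v * x - v\<^sup>2 / 2) \<partial>std_normal) = exp (u * v)"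
    and "integrable std_normal (\<lambda>x. exp (u * x - u\<^sup>2 / 2) * exp (v * x - v\<^sup>2 / 2))"
proof -
  have eq: "exp (u * x - u\<^sup>2 / 2) * exp (v * x - v\<^sup>2 / 2) =
      exp (u * v) * exp ((u + v) * x - (u + v)\<^sup>2 / 2)" for x
    by (simp add: exp_add [symmetric] power2_eq_square field_simps)
  show "(\<integral>x. exp (u * x - u\<^sup>2 / 2) * exp (v * x - v\<^sup>2 / 2) \<partial>std_normal) = exp (u * v)"
    unfolding eq using integrable_std_normal_mgf[of "u + v"] integral_std_normal_mgf[of "u + v"] by simp
  show "integrable std_normal (\<lambda>x. exp (u * x - u\<^sup>2 / 2) * exp (v * x - v\<^sup>2 / 2))"
    unfolding eq using integrable_std_normal_mgf[of "u + v"] by simp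
qed

definition spike :: "nat \<Rightarrow> nat \<Rightarrow> real \<Rightarrow> (nat \<Rightarrow> nat) \<Rightarrow> nat \<Rightarrow> real" where
  "spike s B a p j = (if j \<in> {1..s * B} \<and> p ((j - 1) div B) = (j - 1) mod B then a else 0)"

lemma sum_blocks:
  fixes F :: "nat \<Rightarrow> nat \<Rightarrow> real"
  assumes "0 < B" "s * B \<le> d"
  shows "(\<Sum>j\<in>{1..d}. if j \<in> {1..s * B} then F ((j - 1) div B) ((j - 1) mod B) else 0) =
    (\<Sum>b<s. \<Sum>u<B. F b u)"
proof -
  have "(\<Sum>j\<in>{1..d}. if j \<in> {1..s * B} then F ((j - 1) div B) ((j - 1) mod B) else 0) =
      (\<Sum>j\<in>{1..s * B}. F ((j - 1) div B) ((j - 1) mod B))"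
    using assms by (intro sum.mono_neutral_cong_right) auto
  also have "\<dots> = (\<Sum>i<s * B. F (i div B) (i mod B))"
    by (rule sum.reindex_bij_witness[of _ "\<lambda>i. i + 1" "\<lambda>j. j - 1"]) auto
  also have "\<dots> = (\<Sum>b<s. \<Sum>i = b * B..<b * B + B. F (i div B) (i mod B))"
    by (rule sum.nat_group [symmetric])
  also have "\<dots> = (\<Sum>b<s. \<Sum>u<B. F b u)"
  proof (rule sum.cong[OF refl])
    fix b
    show "(\<Sum>i = b * B..<b * B + B. F (i div B) (i mod B)) = (\<Sum>u<B. F b u)"
    proof (rule sum.reindex_bij_witness[of _ "\<lambda>u. b * B + u" "\<lambda>i. i - b * B"])
      fix i assume i: "i \<in> {b * B..<b * B + B}"
      define u where "u = i - b * B"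
      have u: "u < B" "i = u + b * B" using i by (auto simp: u_def)
      then show "F b (i - b * B) = F (i div B) (i mod B)" by simp
    qed auto
  qed
  finally show ?thesis .
qed

lemma sum_spike:
  assumes "0 < B" "s * B \<le> d" "p \<in> {..<s} \<rightarrow> {..<B}" "G 0 = 0"
  shows "(\<Sum>j\<in>{1..d}. G (spike s B a p j)) = real s * (G a :: real)"
proof -
  have "(\<Sum>j\<in>{1..d}. G (spike s B a p j)) =
      (\<Sum>j\<in>{1..d}. if j \<in> {1..s * B} then (if p ((j - 1) div B) = (j - 1) mod B then G a else 0) else 0)"
    using assms(4) by (intro sum.cong) (auto simp: spike_def)
  also have "\<dots> = (\<Sum>b<s. \<Sum>u<B. if p b = u then G a else 0)"
    using assms(1,2) by (rule sum_blocks)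
  also have "\<dots> = (\<Sum>b<s. G a)"
    using assms(3) by (intro sum.cong refl) (auto simp: Pi_iff)
  finally show ?thesis by simp
qed

lemma sum_spike_product:
  assumes "0 < B" "s * B \<le> d" "p \<in> {..<s} \<rightarrow> {..<B}"
  shows "(\<Sum>j\<in>{1..d}. spike s B a p j * spike s B a p' j) = (\<Sum>b<s. if p b = p' b then a\<^sup>2 else 0)"
proof -
  have "(\<Sum>j\<in>{1..d}. spike s B a p j * spike s B a p' j) =
      (\<Sum>j\<in>{1..d}. if j \<in> {1..s * B} then (if p ((j - 1) div B) = (j - 1) mod B then
        (if p' ((j - 1) div B) = (j - 1) mod B then a\<^sup>2 else 0) else 0) else 0)"
    by (intro sum.cong) (auto simp: spike_def power2_eq_square)
  also have "\<dots> = (\<Sum>b<s. \<Sum>u<B. if p b = u then (if p' b = u then a\<^sup>2 else 0) else 0)"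
    using assms(1,2) by (rule sum_blocks)
  also have "\<dots> = (\<Sum>b<s. if p b = p' b then a\<^sup>2 else 0)"
    using assms(3) by (intro sum.cong refl) (auto simp: Pi_iff)
  finally show ?thesis .
qed

lemma sum_spike_overlap:
  fixes a :: real and s B :: nat
  defines "P \<equiv> {..<s} \<rightarrow>\<^sub>E {..<B}"
  assumes "0 < B" and B: "real s * (exp (a\<^sup>2) - 1) \<le> 2 * real B"
  shows "(\<Sum>p\<in>P. \<Sum>p'\<in>P. exp (\<Sum>b<s. if p b = p' b then a\<^sup>2 else 0)) \<le> 8 * (real (card P))\<^sup>2"
proof -
  define e where "e = (exp (a\<^sup>2) - 1) / real B"
  have e0: "0 \<le> e" by (simp add: e_def)
  have card: "real (card P) = real B ^ s" by (simp add: P_def card_PiE)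
  have inner: "(\<Sum>p'\<in>P. exp (\<Sum>b<s. if p b = p' b then a\<^sup>2 else 0)) = real B ^ s * (1 + e) ^ s"
    if p: "p \<in> P" for p
  proof -
    have "exp (\<Sum>b<s. if p b = p' b then a\<^sup>2 else 0) = (\<Prod>b<s. if p b = p' b then exp (a\<^sup>2) else 1)" for p'
      unfolding exp_sum[OF finite_lessThan] by (intro prod.cong refl) auto
    then have "(\<Sum>p'\<in>P. exp (\<Sum>b<s. if p b = p' b then a\<^sup>2 else 0)) =
        (\<Sum>p'\<in>P. \<Prod>b<s. if p b = p' b then exp (a\<^sup>2) else 1)" by simp
    also have "\<dots> = (\<Prod>b<s. \<Sum>u<B. if p b = u then exp (a\<^sup>2) else 1)"
      unfolding P_def by (rule prod_sum_PiE [symmetric]) auto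
    also have "\<dots> = (\<Prod>b<s. real B * (1 + e))"
    proof (intro prod.cong refl)
      fix b assume "b \<in> {..<s}"
      then have "p b \<in> {..<B}" using p by (auto simp: P_def PiE_iff)
      have "(\<Sum>u<B. if p b = u then exp (a\<^sup>2) else 1) = (\<Sum>u<B. 1 + (if p b = u then exp (a\<^sup>2) - 1 else 0))"
        by (intro sum.cong refl) auto
      also have "\<dots> = real B + (exp (a\<^sup>2) - 1)"
        using \<open>p b \<in> {..<B}\<close> by (simp add: sum.distrib)
      also have "\<dots> = real B * (1 + e)"
        using assms(2) by (simp add: e_def field_simps)
      finally show "(\<Sum>u<B. if p b = u then exp (a\<^sup>2) else 1) = real B * (1 + e)" .
    qed
    finally show ?thesis by (simp add: power_mult_distrib)
  qed
  have "(1 + e) ^ s \<le> exp e ^ s" using e0 by (intro power_mono) auto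
  also have "\<dots> = exp (real s * e)" by (simp add: exp_of_nat_mult)
  also have "\<dots> \<le> exp 2"
    using B assms(2) by (simp add: e_def field_simps)
  also have "\<dots> \<le> 8"
  proof -
    have "exp 2 = exp 1 * exp (1 :: real)" by (simp add: exp_add [symmetric])
    also have "\<dots> \<le> 2.8 * 2.8" using e_less_272 by (intro mult_mono) auto
    finally show ?thesis by simp
  qed
  finally have "(1 + e) ^ s \<le> 8" .
  then have "real B ^ s * real B ^ s * (1 + e) ^ s \<le> real B ^ s * real B ^ s * 8"
    by (intro mult_left_mono) auto
  then show ?thesis
    by (simp add: inner card power2_eq_square mult_ac)
qed

lemma risk_tilt:
  fixes t :: "nat \<Rightarrow> real" and \<sigma> :: real
  assumes T [measurable]: "T \<in> borel_measurable (obs_space d)"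
  defines "\<theta> \<equiv> \<lambda>j\<in>{1..d}. \<sigma> * t j"
  shows "risk d \<sigma> T \<theta> = (\<integral>\<^sup>+x. ennreal ((T (\<lambda>j\<in>{1..d}. \<sigma> * x j) - sqrt (quad d \<theta>))\<^sup>2 *
    (\<Prod>j\<in>{1..d}. exp (t j * x j - (t j)\<^sup>2 / 2))) \<partial>Pi\<^sub>M {1..d} (\<lambda>_. std_normal))"
proof -
  let ?I = "{1..d}" and ?N = "Pi\<^sub>M {1..d} (\<lambda>_. std_normal)"
  let ?g = "\<lambda>x. ennreal ((T (\<lambda>j\<in>?I. \<sigma> * x j) - sqrt (quad d \<theta>))\<^sup>2)"
  have "(\<lambda>x. \<lambda>j\<in>?I. \<sigma> * x j) \<in> measurable (Pi\<^sub>M ?I (\<lambda>_. borel)) (obs_space d)"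
    unfolding obs_space_def by (intro measurable_restrict) measurable
  then have "(\<lambda>x. T (\<lambda>j\<in>?I. \<sigma> * x j)) \<in> borel_measurable (Pi\<^sub>M ?I (\<lambda>_. borel))"
    using T by (rule measurable_compose)
  then have g: "?g \<in> borel_measurable (Pi\<^sub>M ?I (\<lambda>_. borel))" by measurable
  have sets_N: "sets ?N = sets (Pi\<^sub>M ?I (\<lambda>_. borel :: real measure))"
    by (intro sets_PiM_cong) auto
  have gN: "?g \<in> borel_measurable ?N"
    using g measurable_cong_sets[OF sets_N refl] by blast
  have map_meas: "(\<lambda>x. \<lambda>j\<in>?I. t j + x j) \<in> measurable ?N (Pi\<^sub>M ?I (\<lambda>_. borel))"
    by (intro measurable_restrict PiM_std_normal_component[of _ _ "\<lambda>x. t j + x" for j]) auto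
  have dens: "(\<lambda>x. ennreal (\<Prod>j\<in>?I. exp (t j * x j - (t j)\<^sup>2 / 2))) \<in> borel_measurable ?N"
    by (intro measurable_compose[OF _ measurable_ennreal] borel_measurable_prod
        PiM_std_normal_component[of _ _ "\<lambda>x. exp (t j * x - (t j)\<^sup>2 / 2)" for j]) auto
  have "risk d \<sigma> T \<theta> = (\<integral>\<^sup>+x. ennreal ((T (\<lambda>j\<in>?I. \<theta> j + \<sigma> * x j) - sqrt (quad d \<theta>))\<^sup>2) \<partial>?N)"
    unfolding risk_def by (rule nn_integral_obs_measure) measurable
  also have "\<dots> = (\<integral>\<^sup>+x. ?g (\<lambda>j\<in>?I. t j + x j) \<partial>?N)"
  proof (rule nn_integral_cong)
    fix x
    have "(\<lambda>j\<in>?I. \<theta> j + \<sigma> * x j) = (\<lambda>j\<in>?I. \<sigma> * (\<lambda>j\<in>?I. t j + x j) j)"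
      by (rule restrict_ext) (simp add: \<theta>_def distrib_left)
    then show "ennreal ((T (\<lambda>j\<in>?I. \<theta> j + \<sigma> * x j) - sqrt (quad d \<theta>))\<^sup>2) = ?g (\<lambda>j\<in>?I. t j + x j)"
      by (simp only:)
  qed
  also have "\<dots> = (\<integral>\<^sup>+x. ?g x \<partial>distr ?N (Pi\<^sub>M ?I (\<lambda>_. borel)) (\<lambda>x. \<lambda>j\<in>?I. t j + x j))"
    by (rule nn_integral_distr[OF map_meas, symmetric]) (use g in simp)
  also have "\<dots> = (\<integral>\<^sup>+x. ennreal (\<Prod>j\<in>?I. exp (t j * x j - (t j)\<^sup>2 / 2)) * ?g x \<partial>?N)"
    unfolding PiM_std_normal_shift[OF finite_atLeastAtMost] using dens gN by (rule nn_integral_density)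
  also have "\<dots> = (\<integral>\<^sup>+x. ennreal ((T (\<lambda>j\<in>?I. \<sigma> * x j) - sqrt (quad d \<theta>))\<^sup>2 *
      (\<Prod>j\<in>?I. exp (t j * x j - (t j)\<^sup>2 / 2))) \<partial>?N)"
    by (intro nn_integral_cong) (simp add: ennreal_mult prod_nonneg mult.commute)
  finally show ?thesis .
qed

lemma minimax_risk_ge:
  fixes d s :: nat and a \<sigma> q r :: real
  assumes s: "1 \<le> s" "s \<le> d" and a: "0 \<le> a" "exp (a\<^sup>2) \<le> 1 + real d / (real s)\<^sup>2"
    and pos: "0 < \<sigma>" "0 < q" "0 < r" and ball: "\<sigma> * a * real s powr (1 / q) \<le> r"
  shows "ennreal (\<sigma>\<^sup>2 * a\<^sup>2 * real s / 32) \<le> minimax_risk d \<sigma> (lq_ball d q r)"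
  unfolding minimax_risk_def
proof (rule INF_greatest)
  fix T :: "(nat \<Rightarrow> real) \<Rightarrow> real"
  assume T: "T \<in> borel_measurable (obs_space d)"
  let ?I = "{1..d}" and ?N = "Pi\<^sub>M {1..d} (\<lambda>_. std_normal)"
  define B where "B = d div s"
  define P where "P = {..<s} \<rightarrow>\<^sub>E {..<B}"
  define t where "t = spike s B a"
  define \<theta> where "\<theta> p = (\<lambda>j\<in>?I. \<sigma> * t p j)" for p
  define \<rho> where "\<rho> = \<sigma> * a * sqrt (real s)"
  define l where "l p x = (\<Prod>j\<in>?I. exp (t p j * x j - (t p j)\<^sup>2 / 2))" for p and x :: "nat \<Rightarrow> real"
  let ?T = "\<lambda>x. T (\<lambda>j\<in>?I. \<sigma> * x j)"
  have B: "0 < B" "s * B \<le> d" using s by (auto simp: B_def div_greater_zero_iff)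
  have B2: "real s * (exp (a\<^sup>2) - 1) \<le> 2 * real B"
  proof -
    have "d \<le> s * B + s" using s mod_less_divisor[of s d] mult_div_mod_eq[of s d] unfolding B_def by linarith
    also have "\<dots> \<le> s * (2 * B)" using B by (simp add: algebra_simps)
    finally have "real d \<le> real s * (2 * real B)" by (metis of_nat_le_iff of_nat_mult of_nat_numeral)
    then have "real d / real s \<le> 2 * real B" using s by (simp add: field_simps)
    moreover have "real s * (exp (a\<^sup>2) - 1) \<le> real s * (real d / (real s)\<^sup>2)"
      using a by (intro mult_left_mono) auto
    ultimately show ?thesis using s by (simp add: power2_eq_square)
  qed
  have P_Pi: "p \<in> {..<s} \<rightarrow> {..<B}" if "p \<in> P" for p using that by (auto simp: P_def)
  have P: "finite P" "P \<noteq> {}"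
    using B by (auto simp: P_def PiE_eq_empty_iff intro!: finite_PiE)
  have N: "prob_space ?N" by (intro prob_space_PiM prob_space_std_normal)
  have T_meas: "?T \<in> borel_measurable ?N"
  proof -
    have "(\<lambda>x. \<lambda>j\<in>?I. \<sigma> * x j) \<in> measurable ?N (obs_space d)"
      unfolding obs_space_def
      by (intro measurable_restrict PiM_std_normal_component[of _ _ "\<lambda>x. \<sigma> * x"]) auto
    then show ?thesis using T by (rule measurable_compose)
  qed
  have zero_mem: "(\<lambda>j\<in>?I. \<sigma> * 0) \<in> lq_ball d q r"
    using pos by (simp add: lq_ball_def lq_norm_def)
  have mem: "\<theta> p \<in> lq_ball d q r" if "p \<in> P" for p
  proof -
    have "(\<Sum>j\<in>?I. \<bar>\<theta> p j\<bar> powr q) = (\<Sum>j\<in>?I. \<bar>\<sigma> * spike s B a p j\<bar> powr q)"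
      by (simp add: \<theta>_def t_def)
    also have "\<dots> = real s * (\<bar>\<sigma> * a\<bar> powr q)"
      by (rule sum_spike[OF B P_Pi[OF that], where G = "\<lambda>u. \<bar>\<sigma> * u\<bar> powr q"]) simp
    finally have "lq_norm d q (\<theta> p) = (real s * (\<bar>\<sigma> * a\<bar> powr q)) powr (1 / q)"
      by (simp add: lq_norm_def)
    also have "\<dots> = \<sigma> * a * real s powr (1 / q)"
      using pos a by (simp add: powr_mult powr_powr)
    finally show ?thesis using ball by (simp add: lq_ball_def \<theta>_def)
  qed
  have quad: "sqrt (quad d (\<theta> p)) = \<rho>" if "p \<in> P" for p
  proof -
    have "quad d (\<theta> p) = (\<Sum>j\<in>?I. (\<sigma> * spike s B a p j)\<^sup>2)"
      by (simp add: quad_def \<theta>_def t_def)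
    also have "\<dots> = real s * (\<sigma> * a)\<^sup>2"
      by (rule sum_spike[OF B P_Pi[OF that], where G = "\<lambda>u. (\<sigma> * u)\<^sup>2"]) simp
    finally show ?thesis
      using pos a by (simp add: \<rho>_def real_sqrt_mult)
  qed
  have l_int: "integrable ?N (l p)" "integral\<^sup>L ?N (l p) = 1" for p
    using integrable_PiM_prod_subset[where M = "\<lambda>_. std_normal" and I = ?I and J = ?I
        and f = "\<lambda>j x. exp (t p j * x - (t p j)\<^sup>2 / 2)", OF prob_space_std_normal]
      integral_PiM_prod_subset[where M = "\<lambda>_. std_normal" and I = ?I and J = ?I
        and f = "\<lambda>j x. exp (t p j * x - (t p j)\<^sup>2 / 2)", OF prob_space_std_normal]
    unfolding l_def [abs_def] integral_std_normal_mgf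
    by (simp_all add: integrable_std_normal_mgf)
  have l_prod: "l p x * l p' x = (\<Prod>j\<in>?I. exp (t p j * x j - (t p j)\<^sup>2 / 2) *
      exp (t p' j * x j - (t p' j)\<^sup>2 / 2))" for p p' x
    by (simp add: l_def prod.distrib)
  have l2_int: "integrable ?N (\<lambda>x. l p x * l p' x)" for p p'
    unfolding l_prod
    by (rule integrable_PiM_prod_subset[where M = "\<lambda>_. std_normal" and I = ?I and J = ?I
        and f = "\<lambda>j x. exp (t p j * x - (t p j)\<^sup>2 / 2) * exp (t p' j * x - (t p' j)\<^sup>2 / 2)"])
      (simp_all add: prob_space_std_normal integral_std_normal_mgf_product)
  have l2: "(\<integral>x. l p x * l p' x \<partial>?N) = exp (\<Sum>b<s. if p b = p' b then a\<^sup>2 else 0)"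
    if "p \<in> P" for p p'
  proof -
    have "(\<integral>x. l p x * l p' x \<partial>?N) = (\<Prod>j\<in>?I. \<integral>x. exp (t p j * x - (t p j)\<^sup>2 / 2) *
        exp (t p' j * x - (t p' j)\<^sup>2 / 2) \<partial>std_normal)"
      unfolding l_prod
      by (rule integral_PiM_prod_subset[where M = "\<lambda>_. std_normal" and I = ?I and J = ?I
        and f = "\<lambda>j x. exp (t p j * x - (t p j)\<^sup>2 / 2) * exp (t p' j * x - (t p' j)\<^sup>2 / 2)"])
        (simp_all add: prob_space_std_normal integral_std_normal_mgf_product)
    also have "\<dots> = exp (\<Sum>j\<in>?I. t p j * t p' j)"
      by (simp add: integral_std_normal_mgf_product exp_sum)
    also have "(\<Sum>j\<in>?I. t p j * t p' j) = (\<Sum>b<s. if p b = p' b then a\<^sup>2 else 0)"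
      unfolding t_def by (rule sum_spike_product[OF B P_Pi[OF that]])
    finally show ?thesis .
  qed
  have "ennreal (\<rho>\<^sup>2 / 32) \<le> max_risk d \<sigma> (lq_ball d q r) T"
  proof (rule mixture_lower_bound[where T = ?T and l = l and P = P, OF N T_meas P])
    show "0 \<le> l p x" for p x by (simp add: l_def prod_nonneg)
    show "(\<Sum>p\<in>P. \<Sum>p'\<in>P. \<integral>x. l p x * l p' x \<partial>?N) \<le> 8 * (real (card P))\<^sup>2"
    proof -
      have "(\<Sum>p\<in>P. \<Sum>p'\<in>P. \<integral>x. l p x * l p' x \<partial>?N) =
          (\<Sum>p\<in>P. \<Sum>p'\<in>P. exp (\<Sum>b<s. if p b = p' b then a\<^sup>2 else 0))"
        by (intro sum.cong refl l2)
      also have "\<dots> \<le> 8 * (real (card P))\<^sup>2"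
        unfolding P_def by (rule sum_spike_overlap[OF B(1) B2])
      finally show ?thesis .
    qed
    have "(\<integral>\<^sup>+x. ennreal ((?T x)\<^sup>2) \<partial>?N) = risk d \<sigma> T (\<lambda>j\<in>?I. \<sigma> * 0)"
      by (subst risk_tilt[OF T]) (simp add: quad_def)
    also have "\<dots> \<le> max_risk d \<sigma> (lq_ball d q r) T"
      unfolding max_risk_def using zero_mem by (rule SUP_upper)
    finally show "(\<integral>\<^sup>+x. ennreal ((?T x)\<^sup>2) \<partial>?N) \<le> max_risk d \<sigma> (lq_ball d q r) T" .
    fix p assume p: "p \<in> P"
    have "(\<integral>\<^sup>+x. ennreal ((?T x - \<rho>)\<^sup>2 * l p x) \<partial>?N) = risk d \<sigma> T (\<theta> p)"
      unfolding \<theta>_def by (subst risk_tilt[OF T]) (simp only: quad[OF p, unfolded \<theta>_def] l_def)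
    also have "\<dots> \<le> max_risk d \<sigma> (lq_ball d q r) T"
      unfolding max_risk_def using mem[OF p] by (rule SUP_upper)
    finally show "(\<integral>\<^sup>+x. ennreal ((?T x - \<rho>)\<^sup>2 * l p x) \<partial>?N) \<le> max_risk d \<sigma> (lq_ball d q r) T" .
  qed (use l_int l2_int in auto)
  then show "ennreal (\<sigma>\<^sup>2 * a\<^sup>2 * real s / 32) \<le> max_risk d \<sigma> (lq_ball d q r) T"
    by (simp add: \<rho>_def power_mult_distrib)
qed

section \<open>The rate\<close>

lemma ln_ge_one_minus_inverse: "1 - 1 / x \<le> ln x" if "0 < x" for x :: real
  using ln_le_minus_one[of "1 / x"] that by (simp add: ln_div)

lemma powr_inverse_sq: "(x powr (1 / q))\<^sup>2 = x powr (2 / q)" for x q :: real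
  by (simp add: power2_eq_square flip: powr_add)

lemma dense_radius_ge:
  fixes \<sigma> q r :: real and d :: nat
  defines "m \<equiv> m_index \<sigma> q r d" and "s \<equiv> nat \<lfloor>sqrt (real d)\<rfloor>"
  assumes pos: "0 < \<sigma>" "0 < r" "0 < q" "q < 2" and d: "1 \<le> d" and m: "sqrt (real d) < real m"
  shows "\<sigma>\<^sup>2 * (1 / 5) * real s powr (2 / q) \<le> r\<^sup>2"
proof -
  have s: "1 \<le> s" "real s \<le> sqrt (real d)"
    using d by (simp_all add: s_def le_nat_floor)
  have m1: "1 \<le> m" using m by (cases m) auto
  have d_less: "real d < (real m)\<^sup>2"
    using power_strict_mono[OF m, of 2] by simp
  have sm: "real s \<le> real m" using s m by linarith
  have mem: "\<sigma>\<^sup>2 * ln (1 + real d / (real m)\<^sup>2) * real m powr (2 / q) \<le> r\<^sup>2"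
    using m_index_mem[of \<sigma> q r d] m1 by (simp add: m_def mem_index_set)
  have "1 / 5 * real s powr (2 / q) \<le> ln (1 + real d / (real m)\<^sup>2) * real m powr (2 / q)"
  proof (cases "finite (index_set \<sigma> q r d)")
    case True
    then have q: "q \<le> 1" using infinite_index_set[of q r \<sigma> d] pos by (cases "q \<le> 1") auto
    have "real d / (2 * (real m)\<^sup>2) \<le> 1 - 1 / (1 + real d / (real m)\<^sup>2)"
    proof -
      have M: "0 < (real m)\<^sup>2" using m1 by simp
      have le: "real d / (2 * (real m)\<^sup>2) \<le> real d / ((real m)\<^sup>2 + real d)"
        using M d_less by (intro divide_left_mono mult_pos_pos add_pos_nonneg) auto
      have "1 + real d / (real m)\<^sup>2 = ((real m)\<^sup>2 + real d) / (real m)\<^sup>2"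
        using M by (simp add: add_divide_distrib)
      then have "real d / ((real m)\<^sup>2 + real d) = 1 - 1 / (1 + real d / (real m)\<^sup>2)"
        using M add_pos_nonneg[OF M of_nat_0_le_iff[of d]] by (simp add: field_simps)
      then show ?thesis using le by simp
    qed
    also have "\<dots> \<le> ln (1 + real d / (real m)\<^sup>2)"
      by (intro ln_ge_one_minus_inverse) (simp add: add_pos_nonneg)
    finally have ln: "real d / (2 * (real m)\<^sup>2) \<le> ln (1 + real d / (real m)\<^sup>2)" .
    have e: "real x powr (2 / q) = (real x)\<^sup>2 * real x powr (2 / q - 2)" if "1 \<le> x" for x
      using that by (simp add: powr_diff)
    have "(real s)\<^sup>2 \<le> real d"
      using power_mono[OF s(2), of 2] by simp
    then have "1 / 5 * (real s)\<^sup>2 \<le> real d / 2"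
      using zero_le_power2[of "real s"] by linarith
    then have "1 / 5 * real s powr (2 / q) \<le> real d / 2 * real m powr (2 / q - 2)"
      unfolding e[OF s(1)] mult.assoc [symmetric] using sm q pos
      by (intro mult_mono powr_mono2) (auto simp: field_simps)
    also have "\<dots> = real d / (2 * (real m)\<^sup>2) * real m powr (2 / q)"
      using m1 by (simp add: powr_diff)
    also have "\<dots> \<le> ln (1 + real d / (real m)\<^sup>2) * real m powr (2 / q)"
      using ln by (rule mult_right_mono) simp
    finally show ?thesis .
  next
    case False
    then have "m \<le> s + 1"
      unfolding m_def s_def by (rule m_index_infinite)
    then have "real m \<le> 2 * real s" using s by linarith
    then have "(real m)\<^sup>2 \<le> (2 * real s)\<^sup>2" by (intro power_mono) auto
    also have "\<dots> = 4 * (real s)\<^sup>2" by (simp add: power_mult_distrib)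
    also have "(real s)\<^sup>2 \<le> real d" using power_mono[OF s(2), of 2] by simp
    finally have "(real m)\<^sup>2 \<le> 4 * real d" by simp
    then have "5 / 4 \<le> 1 + real d / (real m)\<^sup>2" using m1 by (simp add: field_simps)
    then have "ln (5 / 4) \<le> ln (1 + real d / (real m)\<^sup>2)"
      by (subst ln_le_cancel_iff) (auto intro: add_pos_nonneg)
    then have "1 / 5 \<le> ln (1 + real d / (real m)\<^sup>2)"
      using ln_ge_one_minus_inverse[of "5 / 4"] by simp
    then show ?thesis
      using sm pos by (intro mult_mono powr_mono2) auto
  qed
  then have "\<sigma>\<^sup>2 * (1 / 5 * real s powr (2 / q)) \<le>
      \<sigma>\<^sup>2 * (ln (1 + real d / (real m)\<^sup>2) * real m powr (2 / q))"
    by (rule mult_left_mono) simp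
  then show ?thesis using mem by (simp add: mult.assoc)
qed

theorem theorem9:
  fixes q :: real
  assumes "0 < q" and "q < 2"
  shows "\<exists>C>0. \<exists>c>0. \<forall>d\<ge>1. \<forall>r>0. \<forall>\<sigma>>0.
    max_risk d \<sigma> (lq_ball d q r) (N_hat \<sigma> q r d) \<le> ennreal (C * rate \<sigma> q r d) \<and>
    minimax_risk d \<sigma> (lq_ball d q r) \<ge> ennreal (c * rate \<sigma> q r d)"
proof -
  define C where "C = 4 * (20 * thresh_const + 4 * thresh_const\<^sup>2) + 1"
  have "33 \<le> 4 * (20 * c + 4 * u) + 1" if "5000 \<le> c" "0 \<le> u" for c u :: real
    using that by simp
  from this[OF thresh_const_ge zero_le_power2] have C: "33 \<le> C"
    by (simp only: C_def)
  have "max_risk d \<sigma> (lq_ball d q r) (N_hat \<sigma> q r d) \<le> ennreal (C * rate \<sigma> q r d) \<and>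
      ennreal (1 / 320 * rate \<sigma> q r d) \<le> minimax_risk d \<sigma> (lq_ball d q r)"
    if d: "1 \<le> d" and r: "0 < r" and \<sigma>: "0 < \<sigma>" for d r \<sigma>
  proof -
    define m where "m = m_index \<sigma> q r d"
    define s where "s = nat \<lfloor>sqrt (real d)\<rfloor>"
    define L where "L = ln (1 + real d / (real m)\<^sup>2)"
    have L0: "0 \<le> L" by (simp add: L_def)
    have sqrt_le: "sqrt (real d) \<le> real d"
    proof -
      have "real d \<le> (real d)\<^sup>2" using d by (simp add: power2_eq_square)
      then show ?thesis by (simp add: real_le_lsqrt)
    qed
    consider (dense) "sqrt (real d) < real m" | (sparse) "1 \<le> m" "real m \<le> sqrt (real d)" | (zero) "m = 0"
      by linarith
    then show ?thesis
    proof cases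
      case dense
      then have rate: "rate \<sigma> q r d = \<sigma>\<^sup>2 * sqrt (real d)"
        by (simp add: rate_def Let_def m_def)
      have "risk d \<sigma> (N_hat \<sigma> q r d) \<theta> \<le> ennreal (C * rate \<sigma> q r d)" for \<theta>
      proof -
        have "risk d \<sigma> (N_hat \<sigma> q r d) \<theta> \<le> ennreal (33 * (\<sigma>\<^sup>2 * sqrt (real d)))"
          using risk_dense_le[OF \<sigma> d] dense by (simp add: m_def)
        also have "\<dots> \<le> ennreal (C * rate \<sigma> q r d)"
          unfolding rate using C by (intro ennreal_leI mult_right_mono) auto
        finally show ?thesis .
      qed
      then have "max_risk d \<sigma> (lq_ball d q r) (N_hat \<sigma> q r d) \<le> ennreal (C * rate \<sigma> q r d)"
        unfolding max_risk_def by (intro SUP_least)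
      moreover have "ennreal (1 / 320 * rate \<sigma> q r d) \<le> minimax_risk d \<sigma> (lq_ball d q r)"
      proof -
        define a where "a = sqrt (1 / 5 :: real)"
        have a: "a\<^sup>2 = 1 / 5" "0 \<le> a" by (simp_all add: a_def)
        have s: "1 \<le> s" "real s \<le> sqrt (real d)" "sqrt (real d) < real s + 1"
          using d floor_sqrt_less[of d] by (simp_all add: s_def le_nat_floor)
        have "s \<le> d" using s(2) sqrt_le by simp
        have "exp (a\<^sup>2) \<le> 2"
        proof -
          have "1 / 5 \<le> ln (2 :: real)" using ln2_ge_two_thirds by linarith
          then have "exp (1 / 5) \<le> exp (ln (2 :: real))" by (simp only: exp_le_cancel_iff)
          then show ?thesis by (simp add: a)
        qed
        also have "2 \<le> 1 + real d / (real s)\<^sup>2"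
          using power_mono[OF s(2), of 2] s(1) by (simp add: field_simps)
        finally have exp_a: "exp (a\<^sup>2) \<le> 1 + real d / (real s)\<^sup>2" .
        have "(\<sigma> * a * real s powr (1 / q))\<^sup>2 = \<sigma>\<^sup>2 * (1 / 5) * real s powr (2 / q)"
          by (simp only: power_mult_distrib a powr_inverse_sq)
        also have "\<dots> \<le> r\<^sup>2"
          unfolding s_def using dense by (intro dense_radius_ge \<sigma> r assms d) (simp add: m_def)
        finally have ball: "\<sigma> * a * real s powr (1 / q) \<le> r"
          by (rule power2_le_imp_le) (use r in simp)
        have "sqrt (real d) \<le> 2 * real s" using s by linarith
        then have "\<sigma>\<^sup>2 * sqrt (real d) \<le> \<sigma>\<^sup>2 * (2 * real s)" by (rule mult_left_mono) simp
        then have "ennreal (1 / 320 * rate \<sigma> q r d) \<le> ennreal (\<sigma>\<^sup>2 * a\<^sup>2 * real s / 32)"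
          unfolding rate a by (intro ennreal_leI) (simp add: mult_ac)
        also have "\<dots> \<le> minimax_risk d \<sigma> (lq_ball d q r)"
          using s(1) \<open>s \<le> d\<close> a(2) exp_a \<sigma> assms(1) r ball by (rule minimax_risk_ge)
        finally show ?thesis .
      qed
      ultimately show ?thesis by blast
    next
      case sparse
      then have rate: "rate \<sigma> q r d = \<sigma>\<^sup>2 * real m * L"
        by (simp add: rate_def Let_def L_def flip: m_def)
      have "max_risk d \<sigma> (lq_ball d q r) (N_hat \<sigma> q r d) \<le> ennreal (C * rate \<sigma> q r d)"
        unfolding max_risk_def rate C_def L_def m_def
        by (intro SUP_least risk_sparse_le \<sigma> r assms) (use sparse in \<open>simp_all add: m_def\<close>)
      moreover have "ennreal (1 / 320 * rate \<sigma> q r d) \<le> minimax_risk d \<sigma> (lq_ball d q r)"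
      proof -
        define a where "a = sqrt L"
        have a: "a\<^sup>2 = L" "0 \<le> a" using L0 by (simp_all add: a_def)
        have "m \<le> d" using sparse sqrt_le by simp
        have exp_a: "exp (a\<^sup>2) \<le> 1 + real d / (real m)\<^sup>2"
          unfolding a L_def by (simp add: add_pos_nonneg)
        have "(\<sigma> * a * real m powr (1 / q))\<^sup>2 = \<sigma>\<^sup>2 * L * real m powr (2 / q)"
          by (simp only: power_mult_distrib a powr_inverse_sq)
        also have "\<dots> \<le> r\<^sup>2"
          using m_index_mem[of \<sigma> q r d] sparse(1) by (simp add: mem_index_set L_def flip: m_def)
        finally have ball: "\<sigma> * a * real m powr (1 / q) \<le> r"
          by (rule power2_le_imp_le) (use r in simp)
        have "ennreal (1 / 320 * rate \<sigma> q r d) \<le> ennreal (\<sigma>\<^sup>2 * a\<^sup>2 * real m / 32)"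
          unfolding rate a using L0 by (intro ennreal_leI) (simp add: mult_ac)
        also have "\<dots> \<le> minimax_risk d \<sigma> (lq_ball d q r)"
          using sparse(1) \<open>m \<le> d\<close> a(2) exp_a \<sigma> assms(1) r ball by (rule minimax_risk_ge)
        finally show ?thesis .
      qed
      ultimately show ?thesis by blast
    next
      case zero
      then have rate: "rate \<sigma> q r d = r\<^sup>2"
        by (simp add: rate_def Let_def not_less flip: m_def)
      have "risk d \<sigma> (N_hat \<sigma> q r d) \<theta> \<le> ennreal (C * rate \<sigma> q r d)" if "\<theta> \<in> lq_ball d q r" for \<theta>
      proof -
        have "risk d \<sigma> (N_hat \<sigma> q r d) \<theta> \<le> ennreal (r\<^sup>2)"
          using zero that by (intro risk_zero_le assms r \<sigma>) (simp_all add: m_def)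
        also have "\<dots> \<le> ennreal (C * rate \<sigma> q r d)"
        proof (rule ennreal_leI)
          have "1 * r\<^sup>2 \<le> C * r\<^sup>2" using C by (intro mult_right_mono) auto
          then show "r\<^sup>2 \<le> C * rate \<sigma> q r d" by (simp add: rate)
        qed
        finally show ?thesis .
      qed
      then have "max_risk d \<sigma> (lq_ball d q r) (N_hat \<sigma> q r d) \<le> ennreal (C * rate \<sigma> q r d)"
        unfolding max_risk_def by (intro SUP_least)
      moreover have "ennreal (1 / 320 * rate \<sigma> q r d) \<le> minimax_risk d \<sigma> (lq_ball d q r)"
      proof -
        have "r\<^sup>2 < \<sigma>\<^sup>2 * ln (1 + real d)"
          using m_index_zero[of \<sigma> q r d] zero by (simp add: mem_index_set flip: m_def)
        then have "(r / \<sigma>)\<^sup>2 \<le> ln (1 + real d)"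
          using \<sigma> by (simp add: power_divide field_simps)
        then have "exp ((r / \<sigma>)\<^sup>2) \<le> exp (ln (1 + real d))" by (simp only: exp_le_cancel_iff)
        also have "\<dots> = 1 + real d" by (rule exp_ln) (simp add: add_pos_nonneg)
        finally have exp_a: "exp ((r / \<sigma>)\<^sup>2) \<le> 1 + real d / (real 1)\<^sup>2" by simp
        have "ennreal (1 / 320 * rate \<sigma> q r d) \<le> ennreal (\<sigma>\<^sup>2 * (r / \<sigma>)\<^sup>2 * real 1 / 32)"
          unfolding rate using \<sigma> by (intro ennreal_leI) (simp add: power_divide)
        also have "\<dots> \<le> minimax_risk d \<sigma> (lq_ball d q r)"
          using \<sigma> r by (intro minimax_risk_ge exp_a d assms) auto
        finally show ?thesis .
      qed
      ultimately show ?thesis by blast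
    qed
  qed
  moreover have "0 < C" using C by linarith
  ultimately show ?thesis
    by (intro exI[of _ C] conjI exI[of _ "1 / 320"]) auto
qed

end
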